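(* Let $\pi=(\pi_1,\dots,\pi_l)$ be a partition of $n\ge1$ and $\mathbf{i}=(i_1,\dots,i_n)\in\mathbb{Z}_{\ge0}^n$. There exists a polynomial $P_{\pi,\mathbf i}(y_0,y_1,\dots)$ with non-negative integer coefficients such that \[ (-1)^{\ell(\pi)}\alpha_\pi(\mathbf i)=P_{\pi,\mathbf i}(-c_0,-c_1,\dots) \] in $Z(\mathcal{H})=\mathrm{End}_{\mathcal H}(\mathbf1)$. Moreover, if $\deg y_i=i$, every monomial appearing in $P_{\pi,\mathbf i}$ with nonzero coefficient has degree at most $|\pi|-\ell(\pi)+|\mathbf i|$, where $|\mathbf i|=i_1+\dots+i_n$.
   Context: Khovanov's Heisenberg category $\mathcal{H}$ is the $\mathbb{C}$-linear strict monoidal category whose objects are finite direct sums of words $Q_\varepsilon=Q_{\varepsilon_1}\otimes\cdots\otimes Q_{\varepsilon_m}$, $\varepsilon_i\in\{+,-\}$ (empty word = unit $\mathbf1$). Morphisms $Q_\varepsilon\to Q_{\varepsilon'}$ are $\mathbb{C}$-linear combinations of isotopy classes (rel boundary) of planar oriented string diagrams with transversal crossings, bottom endpoints reading $\varepsilon$ and top endpoints reading $\varepsilon'$ ($+$ = strand oriented upward at that endpoint, $-$ = downward); composition is vertical stacking (source at bottom), $\otimes$ is horizontal juxtaposition (left factor on the left). Local relations: (1) two upward strands crossing twice equal two parallel upward strands; (2) braid relation for three upward strands; (3) on $Q_+\otimes Q_-$ the double crossing is the identity; (4) on $Q_-\otimes Q_+$ the double crossing equals the identity minus (cap $Q_-\otimes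 Q_+\to\mathbf 1$ followed by cup $\mathbf1\to Q_-\otimes Q_+$); (5) a counterclockwise circle equals $1$; (6) an upward strand with a curl on its left-hand side is $0$. The dot $x\in\mathrm{End}(Q_+)$ is the upward strand with a curl on its right-hand side; $c_k\in\mathrm{End}(\mathbf1)$ is the clockwise circle carrying $k$ dots. By relations (1),(2) there is an algebra homomorphism $\varphi_n\colon\mathbb{C}[S_n]\to\mathrm{End}(Q_+^{\otimes n})$ sending the transposition $s_i=(i\ i{+}1)$ to the crossing of the $i$-th and $(i{+}1)$-th upward strands. For $k\ge1$ let $\gamma_k\in\mathrm{End}(Q_+^{\otimes k})$ be the permutation diagram in which the strand starting at bottom position $j$ ends at top position $j+1$ for $j<k$ and the strand starting at bottom position $k$ ends at top position $1$ (positions numbered left to right); set $\gamma_\pi=\gamma_{\pi_1}\otimes\cdots\otimes\gamma_{\pi_l}\in\mathrm{End}(Q_+^{\otimes n})$. For $f\in\mathrm{End}(Q_+^{\otimes n})$, its closure $\mathrm{Tr}(f)\in\mathrm{End}(\mathbf1)$ is obtained by joining, for each $j$, the $j$-th top endpoint to the $j$-th bottom endpoint by an arc passing to the right of the diagram, the arcs nested (the $n$-th strand innermost), so that they are oriented clockwise; thus $\mathrm{Tr}(x^k)=c_k$. Define $\alpha_\pi(\mathbf i)=\mathrm{Tr}\big((x^{i_1}\otimes\cdots\otimes x^{i_n})\circ\gamma_\pi\big)$. $\ell(\pi)=l$ and $|\pi|=n$. *)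

theory Defs
  imports Complex_Main "HOL-Library.Poly_Mapping"
begin

section \<open>Planar diagrams\<close>

datatype sign = Up | Down

fun opp :: "sign \<Rightarrow> sign" where
  "opp Up = Down"
| "opp Down = Up"

type_synonym word = "sign list"

text \<open>
  Linear combinations of planar oriented string diagrams, in generic position with respect to
  the height function: every diagram is built from identity strands, crossings, cups and caps
  by stacking and juxtaposition.  \<open>g \<cdot> f\<close> places \<open>g\<close> on top of \<open>f\<close>; \<open>f \<otimes> g\<close> places \<open>f\<close> to the
  left of \<open>g\<close>.  \<open>Crossing a b\<close> goes from \<open>[a, b]\<close> to \<open>[b, a]\<close>, \<open>Cup a\<close> from the empty word to
  \<open>[a, opp a]\<close>, and \<open>Cap a\<close> from \<open>[a, opp a]\<close> to the empty word.
\<close>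

datatype diag =
    Ident word
  | Crossing sign sign
  | Cup sign
  | Cap sign
  | Comp diag diag  (infixr "\<cdot>" 70)
  | Tens diag diag  (infixr "\<otimes>" 75)
  | ZeroD word word
  | AddD diag diag  (infixl "\<oplus>" 65)
  | ScaleD complex diag  (infixr "\<odot>" 68)

fun src :: "diag \<Rightarrow> word" where
  "src (Ident w) = w"
| "src (Crossing a b) = [a, b]"
| "src (Cup a) = []"
| "src (Cap a) = [a, opp a]"
| "src (g \<cdot> f) = src f"
| "src (f \<otimes> g) = src f @ src g"
| "src (ZeroD v w) = v"
| "src (f \<oplus> g) = src f"
| "src (z \<odot> f) = src f"

fun tgt :: "diag \<Rightarrow> word" where
  "tgt (Ident w) = w"
| "tgt (Crossing a b) = [b, a]"
| "tgt (Cup a) = [a, opp a]"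
| "tgt (Cap a) = []"
| "tgt (g \<cdot> f) = tgt g"
| "tgt (f \<otimes> g) = tgt f @ tgt g"
| "tgt (ZeroD v w) = w"
| "tgt (f \<oplus> g) = tgt f"
| "tgt (z \<odot> f) = tgt f"

fun wf_diag :: "diag \<Rightarrow> bool" where
  "wf_diag (g \<cdot> f) = (wf_diag g \<and> wf_diag f \<and> src g = tgt f)"
| "wf_diag (f \<otimes> g) = (wf_diag f \<and> wf_diag g)"
| "wf_diag (f \<oplus> g) = (wf_diag f \<and> wf_diag g \<and> src f = src g \<and> tgt f = tgt g)"
| "wf_diag (z \<odot> f) = wf_diag f"
| "wf_diag _ = True"

definition hom :: "word \<Rightarrow> word \<Rightarrow> diag set" where
  "hom v w = {f. wf_diag f \<and> src f = v \<and> tgt f = w}"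


section \<open>The relations of the Heisenberg category\<close>

inductive monoidal_rel :: "diag \<Rightarrow> diag \<Rightarrow> bool" where
  m_comp_assoc: "monoidal_rel ((h \<cdot> g) \<cdot> f) (h \<cdot> (g \<cdot> f))"
| m_id_left: "monoidal_rel (Ident (tgt f) \<cdot> f) f"
| m_id_right: "monoidal_rel (f \<cdot> Ident (src f)) f"
| m_tens_assoc: "monoidal_rel ((f \<otimes> g) \<otimes> h) (f \<otimes> (g \<otimes> h))"
| m_unit_left: "monoidal_rel (Ident [] \<otimes> f) f"
| m_unit_right: "monoidal_rel (f \<otimes> Ident []) f"
| m_tens_id: "monoidal_rel (Ident v \<otimes> Ident w) (Ident (v @ w))"
| m_interchange: "monoidal_rel ((g \<cdot> f) \<otimes> (g' \<cdot> f')) ((g \<otimes> g') \<cdot> (f \<otimes> f'))"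

inductive linear_rel :: "diag \<Rightarrow> diag \<Rightarrow> bool" where
  l_add_assoc: "linear_rel ((f \<oplus> g) \<oplus> h) (f \<oplus> (g \<oplus> h))"
| l_add_comm: "linear_rel (f \<oplus> g) (g \<oplus> f)"
| l_add_zero: "linear_rel (f \<oplus> ZeroD (src f) (tgt f)) f"
| l_scale_one: "linear_rel (1 \<odot> f) f"
| l_scale_zero: "linear_rel (0 \<odot> f) (ZeroD (src f) (tgt f))"
| l_scale_scale: "linear_rel (z \<odot> w \<odot> f) ((z * w) \<odot> f)"
| l_scale_add: "linear_rel (z \<odot> (f \<oplus> g)) ((z \<odot> f) \<oplus> (z \<odot> g))"
| l_add_scale: "linear_rel ((z + w) \<odot> f) ((z \<odot> f) \<oplus> (w \<odot> f))"
| l_comp_add_left: "linear_rel ((g \<oplus> g') \<cdot> f) ((g \<cdot> f) \<oplus> (g' \<cdot> f))"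
| l_comp_add_right: "linear_rel (g \<cdot> (f \<oplus> f')) ((g \<cdot> f) \<oplus> (g \<cdot> f'))"
| l_comp_scale_left: "linear_rel ((z \<odot> g) \<cdot> f) (z \<odot> (g \<cdot> f))"
| l_comp_scale_right: "linear_rel (g \<cdot> (z \<odot> f)) (z \<odot> (g \<cdot> f))"
| l_tens_add_left: "linear_rel ((f \<oplus> f') \<otimes> g) ((f \<otimes> g) \<oplus> (f' \<otimes> g))"
| l_tens_add_right: "linear_rel (f \<otimes> (g \<oplus> g')) ((f \<otimes> g) \<oplus> (f \<otimes> g'))"
| l_tens_scale_left: "linear_rel ((z \<odot> f) \<otimes> g) (z \<odot> (f \<otimes> g))"
| l_tens_scale_right: "linear_rel (f \<otimes> (z \<odot> g)) (z \<odot> (f \<otimes> g))"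

text \<open>
  Besides the exchange of heights of distant pieces (the interchange law), planar isotopy rel
  boundary of diagrams with transversal crossings is generated by two kinds of moves, for all
  orientations of the strands: straightening a zigzag (cancelling a local maximum against a
  local minimum), and moving a crossing past a local extremum of one of its two strands.
  No Reidemeister move is a planar isotopy.
\<close>

inductive isotopy_rel :: "diag \<Rightarrow> diag \<Rightarrow> bool" where
  zigzag_left:
    "isotopy_rel ((Cap a \<otimes> Ident [a]) \<cdot> (Ident [a] \<otimes> Cup (opp a))) (Ident [a])"
| zigzag_right:
    "isotopy_rel ((Ident [a] \<otimes> Cap (opp a)) \<cdot> (Cup a \<otimes> Ident [a])) (Ident [a])"
| slide_cap:
    "isotopy_rel ((Cap a \<otimes> Ident [b]) \<cdot> (Ident [a] \<otimes> Crossing b (opp a)))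
                 ((Ident [b] \<otimes> Cap a) \<cdot> (Crossing a b \<otimes> Ident [opp a]))"
| slide_cup:
    "isotopy_rel ((Ident [a] \<otimes> Crossing (opp a) b) \<cdot> (Cup a \<otimes> Ident [b]))
                 ((Crossing b a \<otimes> Ident [opp a]) \<cdot> (Ident [b] \<otimes> Cup a))"

inductive local_rel :: "diag \<Rightarrow> diag \<Rightarrow> bool" where
  double_up_up:
    "local_rel (Crossing Up Up \<cdot> Crossing Up Up) (Ident [Up, Up])"
| braid:
    "local_rel
      ((Crossing Up Up \<otimes> Ident [Up]) \<cdot> (Ident [Up] \<otimes> Crossing Up Up) \<cdot> (Crossing Up Up \<otimes> Ident [Up]))
      ((Ident [Up] \<otimes> Crossing Up Up) \<cdot> (Crossing Up Up \<otimes> Ident [Up]) \<cdot> (Ident [Up] \<otimes> Crossing Up Up))"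
| double_up_down:
    "local_rel (Crossing Down Up \<cdot> Crossing Up Down) (Ident [Up, Down])"
| double_down_up:
    "local_rel (Crossing Up Down \<cdot> Crossing Down Up)
               (Ident [Down, Up] \<oplus> (-1) \<odot> (Cup Down \<cdot> Cap Down))"
| counterclockwise_circle:
    "local_rel (Cap Down \<cdot> Cup Down) (Ident [])"
| left_curl:
    "local_rel
      ((Cap Down \<otimes> Ident [Up]) \<cdot> (Ident [Down] \<otimes> Crossing Up Up) \<cdot> (Cup Down \<otimes> Ident [Up]))
      (ZeroD [Up] [Up])"

lemma isotopy_rel_hom:
  "isotopy_rel f g \<Longrightarrow> f \<in> hom (src f) (tgt f) \<and> g \<in> hom (src f) (tgt f)"
proof (induction rule: isotopy_rel.induct)
  case (zigzag_left a) show ?case by (cases a) (auto simp: hom_def)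
next
  case (zigzag_right a) show ?case by (cases a) (auto simp: hom_def)
next
  case (slide_cap a b) show ?case by (auto simp: hom_def)
next
  case (slide_cup a b) show ?case by (auto simp: hom_def)
qed

lemma local_rel_hom:
  "local_rel f g \<Longrightarrow> f \<in> hom (src f) (tgt f) \<and> g \<in> hom (src f) (tgt f)"
  by (induction rule: local_rel.induct) (auto simp: hom_def)

text \<open>
  Equality of morphisms: the congruence generated by the relations above between well-formed
  parallel expressions.  The space of morphisms from \<open>v\<close> to \<open>w\<close> is \<open>hom v w\<close> modulo \<open>heq\<close>.
  An ill-formed expression is never identified with a well-formed one.
\<close>

inductive heq :: "diag \<Rightarrow> diag \<Rightarrow> bool" where
  heq_rel: "monoidal_rel f g \<or> linear_rel f g \<or> isotopy_rel f g \<or> local_rel f g \<Longrightarrow>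
        f \<in> hom v w \<Longrightarrow> g \<in> hom v w \<Longrightarrow> heq f g"
| heq_refl: "heq f f"
| heq_sym: "heq f g \<Longrightarrow> heq g f"
| heq_trans: "heq f g \<Longrightarrow> heq g h \<Longrightarrow> heq f h"
| heq_comp: "heq g g' \<Longrightarrow> heq f f' \<Longrightarrow> heq (g \<cdot> f) (g' \<cdot> f')"
| heq_tens: "heq f f' \<Longrightarrow> heq g g' \<Longrightarrow> heq (f \<otimes> g) (f' \<otimes> g')"
| heq_add: "heq f f' \<Longrightarrow> heq g g' \<Longrightarrow> heq (f \<oplus> g) (f' \<oplus> g')"
| heq_scale: "heq f f' \<Longrightarrow> heq (z \<odot> f) (z \<odot> f')"

lemma heq_parallel:
  assumes "heq f g"
  shows "src f = src g \<and> tgt f = tgt g \<and> wf_diag f = wf_diag g"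
  using assms by induction (auto simp: hom_def)

lemma heq_hom: "heq f g \<Longrightarrow> f \<in> hom v w \<longleftrightarrow> g \<in> hom v w"
  using heq_parallel[of f g] by (auto simp: hom_def)


section \<open>The algebra of endomorphisms of the unit object\<close>

quotient_type end_unit = diag / partial: "\<lambda>f g. f \<in> hom [] [] \<and> g \<in> hom [] [] \<and> heq f g"
proof (rule part_equivpI)
  show "\<exists>x. x \<in> hom [] [] \<and> x \<in> hom [] [] \<and> heq x x"
    by (rule exI[of _ "Ident []"]) (auto simp: hom_def intro: heq_refl)
  show "symp (\<lambda>f g. f \<in> hom [] [] \<and> g \<in> hom [] [] \<and> heq f g)"
    by (auto simp: symp_def intro: heq_sym)
  show "transp (\<lambda>f g. f \<in> hom [] [] \<and> g \<in> hom [] [] \<and> heq f g)"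
    by (auto simp: transp_def intro: heq_trans)
qed

lemma heq_comp_commute:
  assumes "f \<in> hom [] []" "g \<in> hom [] []"
  shows "heq (f \<cdot> g) (g \<cdot> f)"
proof -
  let ?I = "Ident []"
  have f: "wf_diag f" "src f = []" "tgt f = []" and g: "wf_diag g" "src g = []" "tgt g = []"
    using assms by (auto simp: hom_def)
  have M: "heq a b" if "monoidal_rel a b" "a \<in> hom [] []" "b \<in> hom [] []" for a b
    using that heq_rel by blast
  have "heq ((f \<otimes> ?I) \<cdot> (?I \<otimes> g)) (f \<cdot> g)"
    by (intro heq_comp M monoidal_rel.intros) (auto simp: hom_def f g)
  moreover have "heq ((f \<cdot> ?I) \<otimes> (?I \<cdot> g)) ((f \<otimes> ?I) \<cdot> (?I \<otimes> g))"
    by (intro M monoidal_rel.intros) (auto simp: hom_def f g)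
  moreover have "heq ((f \<cdot> ?I) \<otimes> (?I \<cdot> g)) (f \<otimes> g)"
    using m_id_right[of f] m_id_left[of g]
    by (intro heq_tens M) (auto simp: hom_def f g)
  moreover have "heq ((?I \<otimes> g) \<cdot> (f \<otimes> ?I)) (g \<cdot> f)"
    by (intro heq_comp M monoidal_rel.intros) (auto simp: hom_def f g)
  moreover have "heq ((?I \<cdot> f) \<otimes> (g \<cdot> ?I)) ((?I \<otimes> g) \<cdot> (f \<otimes> ?I))"
    by (intro M monoidal_rel.intros) (auto simp: hom_def f g)
  moreover have "heq ((?I \<cdot> f) \<otimes> (g \<cdot> ?I)) (f \<otimes> g)"
    using m_id_left[of f] m_id_right[of g]
    by (intro heq_tens M) (auto simp: hom_def f g)
  ultimately show ?thesis
    by (meson heq_sym heq_trans)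
qed

lift_definition cscale :: "complex \<Rightarrow> end_unit \<Rightarrow> end_unit" is "\<lambda>z f. z \<odot> f"
  by (auto simp: hom_def intro: heq_scale)

instantiation end_unit :: "{comm_ring, comm_monoid_mult}"
begin

lift_definition zero_end_unit :: end_unit is "ZeroD [] []"
  by (auto simp: hom_def intro: heq_refl)

lift_definition one_end_unit :: end_unit is "Ident []"
  by (auto simp: hom_def intro: heq_refl)

lift_definition plus_end_unit :: "end_unit \<Rightarrow> end_unit \<Rightarrow> end_unit" is "\<lambda>f g. f \<oplus> g"
  by (auto simp: hom_def intro: heq_add)

lift_definition uminus_end_unit :: "end_unit \<Rightarrow> end_unit" is "\<lambda>f. (-1) \<odot> f"
  by (auto simp: hom_def intro: heq_scale)

lift_definition minus_end_unit :: "end_unit \<Rightarrow> end_unit \<Rightarrow> end_unit" is "\<lambda>f g. f \<oplus> (-1) \<odot> g"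
  by (auto simp: hom_def intro: heq_add heq_scale)

lift_definition times_end_unit :: "end_unit \<Rightarrow> end_unit \<Rightarrow> end_unit" is "\<lambda>f g. f \<cdot> g"
  by (auto simp: hom_def intro: heq_comp)

instance
proof
  have M: "heq a b" if "monoidal_rel a b" "a \<in> hom [] []" "b \<in> hom [] []" for a b
    using that heq_rel by blast
  have L: "heq a b" if "linear_rel a b" "a \<in> hom [] []" "b \<in> hom [] []" for a b
    using that heq_rel by blast
  fix a b c :: end_unit
  show "a + b + c = a + (b + c)"
    by transfer (auto simp: hom_def intro!: L linear_rel.intros)
  show "a + b = b + a"
    by transfer (auto simp: hom_def intro!: L linear_rel.intros)
  show "0 + a = a"
  proof transfer
    fix f assume "f \<in> hom [] [] \<and> f \<in> hom [] [] \<and> heq f f"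
    then have f: "wf_diag f" "src f = []" "tgt f = []" by (auto simp: hom_def)
    have "heq (ZeroD [] [] \<oplus> f) (f \<oplus> ZeroD [] [])"
      by (intro L linear_rel.intros) (auto simp: hom_def f)
    moreover have "heq (f \<oplus> ZeroD [] []) f"
      using l_add_zero[of f] by (intro L) (auto simp: hom_def f)
    ultimately have "heq (ZeroD [] [] \<oplus> f) f"
      by (rule heq_trans)
    then show "ZeroD [] [] \<oplus> f \<in> hom [] [] \<and> f \<in> hom [] [] \<and> heq (ZeroD [] [] \<oplus> f) f"
      by (auto simp: hom_def f)
  qed
  show "- a + a = 0"
  proof transfer
    fix f assume "f \<in> hom [] [] \<and> f \<in> hom [] [] \<and> heq f f"
    then have f: "wf_diag f" "src f = []" "tgt f = []" by (auto simp: hom_def)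
    have "heq ((-1) \<odot> f \<oplus> f) ((-1) \<odot> f \<oplus> 1 \<odot> f)"
      by (intro heq_add heq_refl heq_sym[OF L] linear_rel.intros) (auto simp: hom_def f)
    moreover have "heq ((-1) \<odot> f \<oplus> 1 \<odot> f) ((-1 + 1) \<odot> f)"
      by (intro heq_sym[OF L] linear_rel.intros) (auto simp: hom_def f)
    moreover have "heq ((-1 + 1) \<odot> f) (ZeroD [] [])"
      using l_scale_zero[of f] by (intro L) (auto simp: hom_def f)
    ultimately have "heq ((-1) \<odot> f \<oplus> f) (ZeroD [] [])"
      by (meson heq_trans)
    then show "(-1) \<odot> f \<oplus> f \<in> hom [] [] \<and> ZeroD [] [] \<in> hom [] [] \<and>
        heq ((-1) \<odot> f \<oplus> f) (ZeroD [] [])"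
      by (auto simp: hom_def f)
  qed
  show "a - b = a + - b"
    by transfer (auto simp: hom_def intro: heq_refl)
  show "a * b * c = a * (b * c)"
    by transfer (auto simp: hom_def intro!: M monoidal_rel.intros)
  show "a * b = b * a"
  proof transfer
    fix f g assume "f \<in> hom [] [] \<and> f \<in> hom [] [] \<and> heq f f" "g \<in> hom [] [] \<and> g \<in> hom [] [] \<and> heq g g"
    then show "f \<cdot> g \<in> hom [] [] \<and> g \<cdot> f \<in> hom [] [] \<and> heq (f \<cdot> g) (g \<cdot> f)"
      using heq_comp_commute[of f g] by (auto simp: hom_def)
  qed
  show "1 * a = a"
  proof transfer
    fix f assume "f \<in> hom [] [] \<and> f \<in> hom [] [] \<and> heq f f"
    then show "Ident [] \<cdot> f \<in> hom [] [] \<and> f \<in> hom [] [] \<and> heq (Ident [] \<cdot> f) f"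
      using m_id_left[of f] M[of "Ident [] \<cdot> f" f] by (auto simp: hom_def)
  qed
  show "(a + b) * c = a * c + b * c"
    by transfer (auto simp: hom_def intro!: L linear_rel.intros)
qed

end


section \<open>Closures of permutation diagrams with dots\<close>

abbreviation ups :: "nat \<Rightarrow> word" where
  "ups n \<equiv> replicate n Up"

abbreviation downs :: "nat \<Rightarrow> word" where
  "downs n \<equiv> replicate n Down"

definition dot :: diag where
  "dot = (Ident [Up] \<otimes> Cap Up) \<cdot> (Crossing Up Up \<otimes> Ident [Down]) \<cdot> (Ident [Up] \<otimes> Cup Up)"

fun dot_pow :: "nat \<Rightarrow> diag" where
  "dot_pow 0 = Ident [Up]"
| "dot_pow (Suc k) = dot \<cdot> dot_pow k"

fun dots :: "nat list \<Rightarrow> diag" where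
  "dots [] = Ident []"
| "dots (i # idx) = dot_pow i \<otimes> dots idx"

text \<open>
  In \<open>cycle_diag k\<close> the strand starting at the last bottom position runs to the first top
  position, crossing each of the other strands once, so that these are shifted to the right by
  one position.
\<close>

fun cycle_diag :: "nat \<Rightarrow> diag" where
  "cycle_diag 0 = Ident []"
| "cycle_diag (Suc 0) = Ident [Up]"
| "cycle_diag (Suc (Suc k)) =
     (Crossing Up Up \<otimes> Ident (ups k)) \<cdot> (Ident [Up] \<otimes> cycle_diag (Suc k))"

fun cycles_diag :: "nat list \<Rightarrow> diag" where
  "cycles_diag [] = Ident []"
| "cycles_diag (k # \<pi>) = cycle_diag k \<otimes> cycles_diag \<pi>"

fun nested_cups :: "nat \<Rightarrow> diag" where
  "nested_cups 0 = Ident []"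
| "nested_cups (Suc n) = (Ident [Up] \<otimes> nested_cups n \<otimes> Ident [Down]) \<cdot> Cup Up"

fun nested_caps :: "nat \<Rightarrow> diag" where
  "nested_caps 0 = Ident []"
| "nested_caps (Suc n) = Cap Up \<cdot> (Ident [Up] \<otimes> nested_caps n \<otimes> Ident [Down])"

definition closure_diag :: "nat \<Rightarrow> diag \<Rightarrow> diag" where
  "closure_diag n f = nested_caps n \<cdot> (f \<otimes> Ident (downs n)) \<cdot> nested_cups n"

definition circle_diag :: "nat \<Rightarrow> diag" where
  "circle_diag k = Cap Up \<cdot> (dot_pow k \<otimes> Ident [Down]) \<cdot> Cup Up"

definition alpha_diag :: "nat list \<Rightarrow> nat list \<Rightarrow> diag" where
  "alpha_diag \<pi> idx = closure_diag (length idx) (dots idx \<cdot> cycles_diag \<pi>)"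

definition cw_circle :: "nat \<Rightarrow> end_unit" where
  "cw_circle k = abs_end_unit (circle_diag k)"

definition alpha :: "nat list \<Rightarrow> nat list \<Rightarrow> end_unit" where
  "alpha \<pi> idx = abs_end_unit (alpha_diag \<pi> idx)"

lemma dot_pow_hom: "dot_pow k \<in> hom [Up] [Up]"
  by (induction k) (auto simp: hom_def dot_def)

lemma dots_hom: "dots idx \<in> hom (ups (length idx)) (ups (length idx))"
  using dot_pow_hom by (induction idx) (auto simp: hom_def)

lemma cycle_diag_hom: "cycle_diag k \<in> hom (ups k) (ups k)"
  by (induction k rule: cycle_diag.induct) (auto simp: hom_def)

lemma cycles_diag_hom: "cycles_diag \<pi> \<in> hom (ups (sum_list \<pi>)) (ups (sum_list \<pi>))"
  using cycle_diag_hom by (induction \<pi>) (auto simp: hom_def replicate_add)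

lemma nested_cups_hom: "nested_cups n \<in> hom [] (ups n @ downs n)"
  by (induction n) (auto simp: hom_def replicate_append_same)

lemma nested_caps_hom: "nested_caps n \<in> hom (ups n @ downs n) []"
  by (induction n) (auto simp: hom_def replicate_append_same)

lemma closure_diag_hom: "f \<in> hom (ups n) (ups n) \<Longrightarrow> closure_diag n f \<in> hom [] []"
  using nested_cups_hom[of n] nested_caps_hom[of n] by (auto simp: hom_def closure_diag_def)

lemma circle_diag_hom: "circle_diag k \<in> hom [] []"
  using dot_pow_hom[of k] by (auto simp: hom_def circle_diag_def)

lemma alpha_diag_hom: "sum_list \<pi> = length idx \<Longrightarrow> alpha_diag \<pi> idx \<in> hom [] []"
  using dots_hom[of idx] cycles_diag_hom[of \<pi>] unfolding alpha_diag_def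
  by (intro closure_diag_hom) (auto simp: hom_def)


section \<open>Partitions and polynomials in countably many variables\<close>

definition is_partition :: "nat \<Rightarrow> nat list \<Rightarrow> bool" where
  "is_partition n \<pi> \<longleftrightarrow> sorted_wrt (\<ge>) \<pi> \<and> (\<forall>k\<in>set \<pi>. k > 0) \<and> sum_list \<pi> = n"

text \<open>The exponent of \<open>y\<^sub>k\<close> in a monomial \<open>m\<close> is \<open>lookup m k\<close>.\<close>

type_synonym monomial = "nat \<Rightarrow>\<^sub>0 nat"

definition mon_degree :: "monomial \<Rightarrow> nat" where
  "mon_degree m = (\<Sum>k\<in>Poly_Mapping.keys m. k * Poly_Mapping.lookup m k)"

definition poly_eval :: "(monomial \<Rightarrow>\<^sub>0 int) \<Rightarrow> (nat \<Rightarrow> end_unit) \<Rightarrow> end_unit" where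
  "poly_eval P y = (\<Sum>m\<in>Poly_Mapping.keys P.
     cscale (of_int (Poly_Mapping.lookup P m)) (\<Prod>k\<in>Poly_Mapping.keys m. y k ^ Poly_Mapping.lookup m k))"

end

theory Submission imports Defs begin

text \<open>
  Write \<open>x\<^sub>j\<close> for a dot on strand \<open>j\<close> and \<open>s\<close> for the crossing of two upward strands.  The relations
  give \<open>s x\<^sub>1 = x\<^sub>2 s + 1\<close> and a formula for moving a clockwise circle from the right of an upward
  strand to its left; the latter expresses \<open>- c\<^sub>k\<close> on the right through dots and the \<open>- c\<^sub>j\<close> on the
  left with non-negative coefficients.  In \<open>End(Q\<^sub>+\<^sup>n)\<close> consider the non-negative combinations of
  \<open>(-1)\<^bsup>\<ell>(\<pi>)\<^esup> (product of - c\<^sub>j on the left) (dots) \<gamma>\<^sub>\<pi>\<close>, filtered by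
  \<open>(sum of the j) + n - \<ell>(\<pi>) + (number of dots)\<close>.  Each cancellation of a crossing splits a cycle, so the
  sign in \<open>x\<^sub>2 s = s x\<^sub>1 - 1\<close> is absorbed by \<open>(-1)\<^sup>\<ell>\<close>.  Hence closing only the last strand maps the cone on
  \<open>n + 1\<close> strands into the cone on \<open>n\<close> strands without raising the degree, and after closing all strands
  one is left with non-negative polynomials in the \<open>- c\<^sub>j\<close>.
\<close>

section \<open>Morphisms as a quotient type\<close>

text \<open>
  Since \<open>heq\<close> is an equivalence relation on all expressions, ill-formed ones included, composition and
  addition are total on the quotient; the laws of a linear monoidal category hold under \<open>mwf\<close> only.
\<close>

quotient_type mor = diag / heq
  by (intro equivpI reflpI sympI transpI) (blast intro: heq_refl heq_sym heq_trans)+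

lift_definition mwf :: "mor \<Rightarrow> bool" is wf_diag using heq_parallel by blast
lift_definition msrc :: "mor \<Rightarrow> word" is src using heq_parallel by blast
lift_definition mtgt :: "mor \<Rightarrow> word" is tgt using heq_parallel by blast
lift_definition mid :: "word \<Rightarrow> mor" is Ident .
lift_definition cross :: "sign \<Rightarrow> sign \<Rightarrow> mor" is Crossing .
lift_definition cup :: "sign \<Rightarrow> mor" is Cup .
lift_definition cap :: "sign \<Rightarrow> mor" is Cap .
lift_definition tens :: "mor \<Rightarrow> mor \<Rightarrow> mor" (infixr "\<boxtimes>" 75) is Tens by (rule heq_tens)

instantiation mor :: "{times, plus, uminus}"
begin
lift_definition times_mor :: "mor \<Rightarrow> mor \<Rightarrow> mor" is Comp by (rule heq_comp)
lift_definition plus_mor :: "mor \<Rightarrow> mor \<Rightarrow> mor" is AddD by (rule heq_add)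
lift_definition uminus_mor :: "mor \<Rightarrow> mor" is "ScaleD (-1)" by (rule heq_scale)
instance ..
end

lemma mwf_simps [simp]:
  "mwf (mid w)" "mwf (cross a b)" "mwf (cup a)" "mwf (cap a)"
  "mwf (g * f) \<longleftrightarrow> mwf g \<and> mwf f \<and> msrc g = mtgt f"
  "mwf (f \<boxtimes> g) \<longleftrightarrow> mwf f \<and> mwf g"
  "mwf (f + g) \<longleftrightarrow> mwf f \<and> mwf g \<and> msrc f = msrc g \<and> mtgt f = mtgt g"
  "mwf (- f) \<longleftrightarrow> mwf f"
  by (transfer, simp)+

lemma msrc_simps [simp]:
  "msrc (mid w) = w" "msrc (cross a b) = [a, b]" "msrc (cup a) = []" "msrc (cap a) = [a, opp a]"
  "msrc (g * f) = msrc f" "msrc (f \<boxtimes> g) = msrc f @ msrc g"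
  "msrc (f + g) = msrc f" "msrc (- f) = msrc f"
  by (transfer, simp)+

lemma mtgt_simps [simp]:
  "mtgt (mid w) = w" "mtgt (cross a b) = [b, a]" "mtgt (cup a) = [a, opp a]" "mtgt (cap a) = []"
  "mtgt (g * f) = mtgt g" "mtgt (f \<boxtimes> g) = mtgt f @ mtgt g"
  "mtgt (f + g) = mtgt f" "mtgt (- f) = mtgt f"
  by (transfer, simp)+

section \<open>The laws of a linear monoidal category in the quotient\<close>

lemma heq_monoidal: "monoidal_rel f g \<Longrightarrow> wf_diag f \<Longrightarrow> wf_diag g \<Longrightarrow> src f = src g \<Longrightarrow> tgt f = tgt g \<Longrightarrow> heq f g"
  by (rule heq_rel) (auto simp: hom_def)

lemma heq_linear: "linear_rel f g \<Longrightarrow> wf_diag f \<Longrightarrow> wf_diag g \<Longrightarrow> src f = src g \<Longrightarrow> tgt f = tgt g \<Longrightarrow> heq f g"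
  by (rule heq_rel) (auto simp: hom_def)

lemma heq_isotopy: "isotopy_rel f g \<Longrightarrow> heq f g"
  using isotopy_rel_hom heq_rel by blast

lemma heq_local: "local_rel f g \<Longrightarrow> heq f g"
  using local_rel_hom heq_rel by blast

lemma comp_assoc: "mwf (h * g * f) \<Longrightarrow> h * g * f = h * (g * f)"
  by transfer (auto intro!: heq_monoidal monoidal_rel.intros)

lemma comp_id_left [simp]: "mwf f \<Longrightarrow> mtgt f = w \<Longrightarrow> mid w * f = f"
  by transfer (auto intro!: heq_monoidal monoidal_rel.intros)

lemma comp_id_right [simp]: "mwf f \<Longrightarrow> msrc f = w \<Longrightarrow> f * mid w = f"
  by transfer (auto intro!: heq_monoidal monoidal_rel.intros)

lemma tens_assoc: "mwf f \<Longrightarrow> mwf g \<Longrightarrow> mwf h \<Longrightarrow> (f \<boxtimes> g) \<boxtimes> h = f \<boxtimes> (g \<boxtimes> h)"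
  by transfer (auto intro!: heq_monoidal monoidal_rel.intros)

lemma tens_unit_left [simp]: "mwf f \<Longrightarrow> mid [] \<boxtimes> f = f"
  by transfer (auto intro!: heq_monoidal monoidal_rel.intros)

lemma tens_unit_right [simp]: "mwf f \<Longrightarrow> f \<boxtimes> mid [] = f"
  by transfer (auto intro!: heq_monoidal monoidal_rel.intros)

lemma tens_id [simp]: "mid v \<boxtimes> mid w = mid (v @ w)"
  by transfer (auto intro!: heq_monoidal monoidal_rel.intros)

lemma interchange:
  "mwf (g * f) \<Longrightarrow> mwf (g' * f') \<Longrightarrow> (g \<boxtimes> g') * (f \<boxtimes> f') = (g * f) \<boxtimes> (g' * f')"
  by transfer (auto intro!: heq_sym[OF heq_monoidal] monoidal_rel.intros)

lemma madd_assoc: "mwf (f + g + h) \<Longrightarrow> f + g + h = f + (g + h)"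
  by transfer (auto intro!: heq_linear linear_rel.intros)

lemma madd_comm: "mwf (f + g) \<Longrightarrow> f + g = g + (f::mor)"
  by transfer (auto intro!: heq_linear linear_rel.intros)

lemma comp_add_left: "mwf ((g + g') * f) \<Longrightarrow> (g + g') * f = g * f + g' * (f::mor)"
  by transfer (auto intro!: heq_linear linear_rel.intros)

lemma comp_add_right: "mwf (g * (f + f')) \<Longrightarrow> g * (f + f') = g * f + g * (f'::mor)"
  by transfer (auto intro!: heq_linear linear_rel.intros)

lemma comp_neg_left: "mwf (g * f) \<Longrightarrow> - g * f = - (g * (f::mor))"
  by transfer (auto intro!: heq_linear linear_rel.intros)

lemma comp_neg_right: "mwf (g * f) \<Longrightarrow> g * - f = - (g * (f::mor))"
  by transfer (auto intro!: heq_linear linear_rel.intros)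

lemma tens_add_left: "mwf ((g + g') \<boxtimes> f) \<Longrightarrow> (g + g') \<boxtimes> f = g \<boxtimes> f + g' \<boxtimes> f"
  by transfer (auto intro!: heq_linear linear_rel.intros)

lemma tens_add_right: "mwf (g \<boxtimes> (f + f')) \<Longrightarrow> g \<boxtimes> (f + f') = g \<boxtimes> f + g \<boxtimes> f'"
  by transfer (auto intro!: heq_linear linear_rel.intros)

lemma tens_neg_left: "mwf (g \<boxtimes> f) \<Longrightarrow> (- g) \<boxtimes> f = - (g \<boxtimes> f)"
  by transfer (auto intro!: heq_linear linear_rel.intros)

lemma tens_neg_right: "mwf (g \<boxtimes> f) \<Longrightarrow> g \<boxtimes> (- f) = - (g \<boxtimes> f)"
  by transfer (auto intro!: heq_linear linear_rel.intros)

lemma neg_neg_mor: "mwf f \<Longrightarrow> - (- f) = (f::mor)"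
proof transfer
  fix f assume f: "wf_diag f"
  have "heq ((-1) \<odot> (-1) \<odot> f) (((-1) * (-1)) \<odot> f)"
    by (intro heq_linear linear_rel.intros) (auto simp: f)
  moreover have "heq (1 \<odot> f) f"
    by (intro heq_linear linear_rel.intros) (auto simp: f)
  ultimately show "heq ((-1) \<odot> (-1) \<odot> f) f" by (auto intro: heq_trans)
qed

lemma neg_add_mor: "mwf (f + g) \<Longrightarrow> - (f + g) = - f + - (g::mor)"
  by transfer (auto intro!: heq_linear linear_rel.intros)

text \<open>Cancellation is phrased without a zero morphism. The proof merges
  \<open>g \<oplus> (-1) \<odot> g\<close> into \<open>0 \<odot> g\<close> and absorbs it.\<close>

lemma add_neg_cancel: "mwf (f + g) \<Longrightarrow> f + g + - g = (f::mor)"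
proof transfer
  fix f g assume fg: "wf_diag (f \<oplus> g)"
  have "heq (f \<oplus> g \<oplus> (-1) \<odot> g) (f \<oplus> (g \<oplus> (-1) \<odot> g))"
    using fg by (intro heq_linear linear_rel.intros) auto
  moreover have "heq (f \<oplus> (g \<oplus> (-1) \<odot> g)) (f \<oplus> (1 \<odot> g \<oplus> (-1) \<odot> g))"
    using fg by (intro heq_add heq_refl heq_sym[OF heq_linear] linear_rel.intros) auto
  moreover have "heq (f \<oplus> (1 \<odot> g \<oplus> (-1) \<odot> g)) (f \<oplus> (1 + -1) \<odot> g)"
    using fg by (intro heq_add heq_refl heq_sym[OF heq_linear] linear_rel.intros) auto
  moreover have "heq (f \<oplus> (1 + -1) \<odot> g) (f \<oplus> ZeroD (src g) (tgt g))"
    using fg l_scale_zero[of g] by (intro heq_add heq_refl heq_linear) auto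
  moreover have "heq (f \<oplus> ZeroD (src g) (tgt g)) f"
    using fg l_add_zero[of f] by (intro heq_linear) auto
  ultimately show "heq (f \<oplus> g \<oplus> (-1) \<odot> g) f" by (meson heq_trans)
qed

lemma neg_add_cancel: "mwf (f + g) \<Longrightarrow> f + - g + g = (f::mor)"
  using add_neg_cancel[of f "- g"] by (simp add: neg_neg_mor)

lemmas linear_mor = comp_add_left comp_add_right comp_neg_left comp_neg_right
  tens_add_left tens_add_right tens_neg_left tens_neg_right neg_neg_mor neg_add_mor

section \<open>The isotopy moves and local relations in the quotient\<close>

lemma zigzag_left_mor [simp]:
  "(cap Up \<boxtimes> mid [Up]) * (mid [Up] \<boxtimes> cup Down) = mid [Up]"
  using zigzag_left[of Up] by transfer (auto intro!: heq_isotopy)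

lemma zigzag_right_mor [simp]:
  "(mid [Up] \<boxtimes> cap Down) * (cup Up \<boxtimes> mid [Up]) = mid [Up]"
  using zigzag_right[of Up] by transfer (auto intro!: heq_isotopy)

lemma slide_cap_mor:
  "(cap Up \<boxtimes> mid [Up]) * (mid [Up] \<boxtimes> cross Up Down)
    = (mid [Up] \<boxtimes> cap Up) * (cross Up Up \<boxtimes> mid [Down])"
  using slide_cap[of Up Up] by transfer (auto intro!: heq_isotopy)

lemma slide_cup_mor:
  "(mid [Up] \<boxtimes> cross Down Up) * (cup Up \<boxtimes> mid [Up])
    = (cross Up Up \<boxtimes> mid [Down]) * (mid [Up] \<boxtimes> cup Up)"
  using slide_cup[of Up Up] by transfer (auto intro!: heq_isotopy)

lemma double_up_up_mor: "cross Up Up * cross Up Up = mid [Up, Up]"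
  by transfer (intro heq_local local_rel.intros)

lemma braid_mor:
  "(cross Up Up \<boxtimes> mid [Up]) * ((mid [Up] \<boxtimes> cross Up Up) * (cross Up Up \<boxtimes> mid [Up]))
    = (mid [Up] \<boxtimes> cross Up Up) * ((cross Up Up \<boxtimes> mid [Up]) * (mid [Up] \<boxtimes> cross Up Up))"
  by transfer (intro heq_local local_rel.intros)

lemma double_up_down_mor: "cross Down Up * cross Up Down = mid [Up, Down]"
  by transfer (intro heq_local local_rel.intros)

lemma double_down_up_mor: "cross Up Down * cross Down Up = mid [Down, Up] + - (cup Down * cap Down)"
  by transfer (intro heq_local local_rel.intros)

lemma counterclockwise_circle_mor: "cap Down * cup Down = mid []"
  by transfer (intro heq_local local_rel.intros)

text \<open>Interchange as an exchange of heights: here \<open>g\<close> lies below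
  \<open>f\<close>, in \<open>tens_comp_right\<close> above it. Combining both slides distant pieces
  past each other.\<close>

lemma tens_comp_left: "mwf f \<Longrightarrow> mwf g \<Longrightarrow> msrc f = v \<Longrightarrow> mtgt g = w \<Longrightarrow> (f \<boxtimes> mid w) * (mid v \<boxtimes> g) = f \<boxtimes> g"
  by (simp add: interchange)

lemma tens_comp_right: "mwf f \<Longrightarrow> mwf g \<Longrightarrow> mtgt f = v \<Longrightarrow> msrc g = w \<Longrightarrow> (mid v \<boxtimes> g) * (f \<boxtimes> mid w) = f \<boxtimes> g"
  by (simp add: interchange)

lemma whisker_left: "mwf (g * f) \<Longrightarrow> (mid w \<boxtimes> g) * (mid w \<boxtimes> f) = mid w \<boxtimes> (g * f)"
  by (simp add: interchange)

lemma whisker_right: "mwf (g * f) \<Longrightarrow> (g \<boxtimes> mid w) * (f \<boxtimes> mid w) = (g * f) \<boxtimes> mid w"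
  by (simp add: interchange)

section \<open>Closing the last strand\<close>

text \<open>The right partial trace. Its iteration is the full closure, innermost strand first; see
  \<open>mclosure_Suc\<close>.\<close>

definition ptrace :: "word \<Rightarrow> mor \<Rightarrow> mor" where
  "ptrace w f = (mid w \<boxtimes> cap Up) * ((f \<boxtimes> mid [Down]) * (mid w \<boxtimes> cup Up))"

lemma ptrace_typing [simp]:
  "mwf f \<Longrightarrow> msrc f = w @ [Up] \<Longrightarrow> mtgt f = w @ [Up] \<Longrightarrow> mwf (ptrace w f)"
  "msrc (ptrace w f) = w" "mtgt (ptrace w f) = w"
  by (simp_all add: ptrace_def)

lemma ptrace_add:
  assumes "mwf f" "msrc f = w @ [Up]" "mtgt f = w @ [Up]" "mwf g" "msrc g = w @ [Up]" "mtgt g = w @ [Up]"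
  shows "ptrace w (f + g) = ptrace w f + ptrace w g"
  using assms by (simp add: ptrace_def linear_mor)

lemma ptrace_neg:
  assumes "mwf f" "msrc f = w @ [Up]" "mtgt f = w @ [Up]"
  shows "ptrace w (- f) = - ptrace w f"
  using assms by (simp add: ptrace_def linear_mor)

text \<open>The factor \<open>g\<close> does not meet the closed strand, so by interchange it moves
  past the cap and leaves the trace at the top. The next two lemmas do the same for a factor below
  and for one to the left.\<close>

lemma ptrace_comp_left:
  assumes "mwf f" "msrc f = w @ [Up]" "mtgt f = w @ [Up]" "mwf g" "msrc g = w" "mtgt g = w"
  shows "ptrace w ((g \<boxtimes> mid [Up]) * f) = g * ptrace w f"
proof -
  have 1: "(((g \<boxtimes> mid [Up]) * f) \<boxtimes> mid [Down]) = (g \<boxtimes> mid [Up, Down]) * (f \<boxtimes> mid [Down])"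
    using assms by (simp add: whisker_right[symmetric] tens_assoc)
  have 2: "(mid w \<boxtimes> cap Up) * (g \<boxtimes> mid [Up, Down]) = g * (mid w \<boxtimes> cap Up)"
    using assms tens_comp_right[of g "cap Up" w "[Up, Down]"] tens_comp_left[of g "cap Up" w "[]"] by simp
  show ?thesis unfolding ptrace_def 1
    using assms by (simp add: comp_assoc[symmetric] 2)
qed

lemma ptrace_comp_right:
  assumes "mwf f" "msrc f = w @ [Up]" "mtgt f = w @ [Up]" "mwf g" "msrc g = w" "mtgt g = w"
  shows "ptrace w (f * (g \<boxtimes> mid [Up])) = ptrace w f * g"
proof -
  have 1: "((f * (g \<boxtimes> mid [Up])) \<boxtimes> mid [Down]) = (f \<boxtimes> mid [Down]) * (g \<boxtimes> mid [Up, Down])"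
    using assms by (simp add: whisker_right[symmetric] tens_assoc)
  have 2: "(g \<boxtimes> mid [Up, Down]) * (mid w \<boxtimes> cup Up) = (mid w \<boxtimes> cup Up) * g"
    using assms tens_comp_left[of g "cup Up" w "[Up, Down]"] tens_comp_right[of g "cup Up" w "[]"] by simp
  show ?thesis unfolding ptrace_def 1
    using assms by (simp add: comp_assoc 2)
qed

lemma ptrace_tens:
  assumes "mwf f" "msrc f = w @ [Up]" "mtgt f = w @ [Up]" "mwf g" "msrc g = v" "mtgt g = v"
  shows "ptrace (v @ w) (g \<boxtimes> f) = g \<boxtimes> ptrace w f"
proof -
  have 1: "mid (v @ w) \<boxtimes> h = mid v \<boxtimes> (mid w \<boxtimes> h)" if "mwf h" for h
    using that tens_assoc[of "mid v" "mid w" h] by simp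
  show ?thesis unfolding ptrace_def
    using assms by (simp add: 1 tens_assoc interchange)
qed

section \<open>Dots as closed crossings, and the degenerate affine Hecke relation\<close>

abbreviation "cr \<equiv> cross Up Up"

lift_definition mdot :: mor is dot .

lemma mdot_eq: "mdot = ptrace [Up] cr"
  unfolding ptrace_def by transfer (simp add: dot_def heq_refl)

lemma mdot_typing [simp]: "mwf mdot" "msrc mdot = [Up]" "mtgt mdot = [Up]"
  by (simp_all add: mdot_eq)

lemma tens_id_Cons: "mwf f \<Longrightarrow> mid [a] \<boxtimes> (mid w \<boxtimes> f) = mid (a # w) \<boxtimes> f"
  using tens_assoc[of "mid [a]" "mid w" f] by simp

text \<open>Moving the cup past the strand makes the two crossings adjacent. Resolving the double
  crossing on \<open>[Down, Up]\<close> yields the uncrossed picture and a cup-cap term, which a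
  zigzag straightens. \<open>slide_strand_cap\<close> is the reflected computation.\<close>

lemma slide_strand_cup:
  "(mid [Up] \<boxtimes> cross Up Down) * ((cr \<boxtimes> mid [Down]) * (mid [Up] \<boxtimes> cup Up))
    = cup Up \<boxtimes> mid [Up] + - (mid [Up] \<boxtimes> cup Down)"
proof -
  have "(mid [Up] \<boxtimes> cross Up Down) * ((cr \<boxtimes> mid [Down]) * (mid [Up] \<boxtimes> cup Up))
     = (mid [Up] \<boxtimes> (cross Up Down * cross Down Up)) * (cup Up \<boxtimes> mid [Up])"
    by (simp add: slide_cup_mor[symmetric] comp_assoc[symmetric] whisker_left)
  also have "\<dots> = cup Up \<boxtimes> mid [Up] + - ((mid [Up] \<boxtimes> (cup Down * cap Down)) * (cup Up \<boxtimes> mid [Up]))"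
    by (simp add: double_down_up_mor linear_mor)
  also have "(mid [Up] \<boxtimes> (cup Down * cap Down)) * (cup Up \<boxtimes> mid [Up]) = mid [Up] \<boxtimes> cup Down"
    by (simp add: whisker_left[symmetric] comp_assoc)
  finally show ?thesis .
qed

lemma slide_strand_cap:
  "((mid [Up] \<boxtimes> cap Up) * (cr \<boxtimes> mid [Down])) * (mid [Up] \<boxtimes> cross Down Up)
    = cap Up \<boxtimes> mid [Up] + - (mid [Up] \<boxtimes> cap Down)"
proof -
  have "((mid [Up] \<boxtimes> cap Up) * (cr \<boxtimes> mid [Down])) * (mid [Up] \<boxtimes> cross Down Up)
     = (cap Up \<boxtimes> mid [Up]) * (mid [Up] \<boxtimes> (cross Up Down * cross Down Up))"
    by (simp add: slide_cap_mor[symmetric] comp_assoc whisker_left)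
  also have "\<dots> = cap Up \<boxtimes> mid [Up] + - ((cap Up \<boxtimes> mid [Up]) * (mid [Up] \<boxtimes> (cup Down * cap Down)))"
    by (simp add: double_down_up_mor linear_mor)
  also have "(cap Up \<boxtimes> mid [Up]) * (mid [Up] \<boxtimes> (cup Down * cap Down)) = mid [Up] \<boxtimes> cap Down"
    by (simp add: whisker_left[symmetric] comp_assoc[symmetric])
  finally show ?thesis .
qed

text \<open>
  By the braid relation, the left-hand side is the curl of strand 1 with its loop passing around strand 2;
  pulling strand 2 out of the loop produces the correction term.
\<close>

lemma cross_mdot_cross: "cr * ((mid [Up] \<boxtimes> mdot) * cr) = mdot \<boxtimes> mid [Up] + - cr"
proof -
  let ?U = "mid [Up]" and ?D = "mid [Down]"
  have mdot2: "?U \<boxtimes> mdot = ptrace [Up, Up] (?U \<boxtimes> cr)"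
    using ptrace_tens[of cr "[Up]" ?U "[Up]"] by (simp add: mdot_eq)
  have "cr * ((?U \<boxtimes> mdot) * cr)
      = ptrace [Up, Up] ((cr \<boxtimes> ?U) * ((?U \<boxtimes> cr) * (cr \<boxtimes> ?U)))"
    using ptrace_comp_right[of "?U \<boxtimes> cr" "[Up, Up]" cr]
      ptrace_comp_left[of "(?U \<boxtimes> cr) * (cr \<boxtimes> ?U)" "[Up, Up]" cr]
    by (simp add: mdot2)
  also have "\<dots> = ptrace [Up, Up] ((?U \<boxtimes> cr) * ((cr \<boxtimes> ?U) * (?U \<boxtimes> cr)))"
    by (simp add: braid_mor)
  also have "\<dots> = (?U \<boxtimes> ((?U \<boxtimes> cap Up) * (cr \<boxtimes> ?D))) * ((cr \<boxtimes> mid [Up, Down]) *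
      (?U \<boxtimes> ((cr \<boxtimes> ?D) * (?U \<boxtimes> cup Up))))"
    by (simp add: ptrace_def whisker_left[symmetric] whisker_right[symmetric] tens_assoc comp_assoc tens_id_Cons)
  \<comment> \<open>\<open>double_up_down_mor\<close> backwards: strand 2, which runs inside the
    loop, is made to cross the closing arc to the outside and come back. The lower and upper parts
    then have the shape of \<open>slide_strand_cup\<close> and
    \<open>slide_strand_cap\<close>.\<close>
  also have "cr \<boxtimes> mid [Up, Down] = (?U \<boxtimes> (?U \<boxtimes> cross Down Up)) * ((cr \<boxtimes> mid [Down, Up]) * (?U \<boxtimes> (?U \<boxtimes> cross Up Down)))"
    by (simp add: tens_id_Cons interchange double_up_down_mor)
  also have "(?U \<boxtimes> ((?U \<boxtimes> cap Up) * (cr \<boxtimes> ?D))) * (((?U \<boxtimes> (?U \<boxtimes> cross Down Up)) * ((cr \<boxtimes> mid [Down, Up]) * (?U \<boxtimes> (?U \<boxtimes> cross Up Down)))) *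
      (?U \<boxtimes> ((cr \<boxtimes> ?D) * (?U \<boxtimes> cup Up)))) = 
     (?U \<boxtimes> (((?U \<boxtimes> cap Up) * (cr \<boxtimes> ?D)) * (?U \<boxtimes> cross Down Up))) *
       ((cr \<boxtimes> mid [Down, Up]) *
     (?U \<boxtimes> ((?U \<boxtimes> cross Up Down) * ((cr \<boxtimes> ?D) * (?U \<boxtimes> cup Up)))))"
    by (simp add: whisker_left[symmetric] comp_assoc)
  also have "\<dots> = (?U \<boxtimes> (cap Up \<boxtimes> ?U + - (?U \<boxtimes> cap Down))) * ((cr \<boxtimes> mid [Down, Up]) *
      (?U \<boxtimes> (cup Up \<boxtimes> ?U + - (?U \<boxtimes> cup Down))))"
    by (simp only: slide_strand_cap slide_strand_cup)
  \<comment> \<open>Of the four terms, the first is the curl of strand 1 with strand 2 outside.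
    Zigzags turn the two mixed terms into crossings, and the last is a crossing times a
    counterclockwise circle, which equals 1; one crossing with a minus sign remains.\<close>
  also have "\<dots> = (?U \<boxtimes> (cap Up \<boxtimes> ?U)) * ((cr \<boxtimes> mid [Down, Up]) * (?U \<boxtimes> (cup Up \<boxtimes> ?U)))
      + - ((?U \<boxtimes> (?U \<boxtimes> cap Down)) * ((cr \<boxtimes> mid [Down, Up]) * (?U \<boxtimes> (cup Up \<boxtimes> ?U))))
      + - ((?U \<boxtimes> (cap Up \<boxtimes> ?U)) * ((cr \<boxtimes> mid [Down, Up]) * (?U \<boxtimes> (?U \<boxtimes> cup Down)))
         + - ((?U \<boxtimes> (?U \<boxtimes> cap Down)) * ((cr \<boxtimes> mid [Down, Up]) * (?U \<boxtimes> (?U \<boxtimes> cup Down)))))"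
    by (simp add: linear_mor)
  also have "(?U \<boxtimes> (cap Up \<boxtimes> ?U)) * ((cr \<boxtimes> mid [Down, Up]) * (?U \<boxtimes> (cup Up \<boxtimes> ?U))) = mdot \<boxtimes> ?U"
  proof -
    have "cr \<boxtimes> mid [Down, Up] = (cr \<boxtimes> ?D) \<boxtimes> ?U" by (simp add: tens_assoc)
    then show ?thesis
      by (simp add: mdot_eq ptrace_def tens_assoc[symmetric] whisker_right)
  qed
  also have "(?U \<boxtimes> (cap Up \<boxtimes> ?U)) * ((cr \<boxtimes> mid [Down, Up]) * (?U \<boxtimes> (?U \<boxtimes> cup Down))) = cr"
  proof -
    have "(cr \<boxtimes> mid [Down, Up]) * (?U \<boxtimes> (?U \<boxtimes> cup Down)) = (?U \<boxtimes> (?U \<boxtimes> cup Down)) * cr"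
      using tens_comp_right[of cr "cup Down" "[Up, Up]" "[]"] by (simp add: tens_id_Cons tens_comp_left)
    then show ?thesis by (simp add: comp_assoc[symmetric] whisker_left)
  qed
  also have "(?U \<boxtimes> (?U \<boxtimes> cap Down)) * ((cr \<boxtimes> mid [Down, Up]) * (?U \<boxtimes> (cup Up \<boxtimes> ?U))) = cr"
  proof -
    have "(?U \<boxtimes> (?U \<boxtimes> cap Down)) * (cr \<boxtimes> mid [Down, Up]) = cr * (?U \<boxtimes> (?U \<boxtimes> cap Down))"
      using tens_comp_left[of cr "cap Down" "[Up, Up]" "[]"] by (simp add: tens_id_Cons tens_comp_right)
    then show ?thesis by (simp add: comp_assoc[symmetric]) (simp add: comp_assoc whisker_left)
  qed
  also have "(?U \<boxtimes> (?U \<boxtimes> cap Down)) * ((cr \<boxtimes> mid [Down, Up]) * (?U \<boxtimes> (?U \<boxtimes> cup Down))) = cr"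
    by (simp add: tens_id_Cons interchange counterclockwise_circle_mor)
  also have "mdot \<boxtimes> ?U + - cr + - (cr + - cr) = mdot \<boxtimes> ?U + - cr"
  proof -
    have "- (cr + - cr) = cr + - cr" by (simp add: linear_mor madd_comm)
    then show ?thesis by (simp add: madd_assoc[symmetric] add_neg_cancel)
  qed
  finally show ?thesis .
qed

text \<open>The degenerate affine Hecke relation: \<open>cross_mdot_cross\<close> multiplied by
  \<open>cr\<close>, whose square is the identity. The three lemmas after it are the other forms,
  from multiplying on the right and from solving for the other side.\<close>

lemma cross_mdot1: "cr * (mdot \<boxtimes> mid [Up]) = (mid [Up] \<boxtimes> mdot) * cr + mid [Up, Up]"
proof -
  have "mdot \<boxtimes> mid [Up] = cr * ((mid [Up] \<boxtimes> mdot) * cr) + cr"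
    using neg_add_cancel[of "mdot \<boxtimes> mid [Up]" cr] by (simp add: cross_mdot_cross)
  then show ?thesis
    by (simp add: linear_mor double_up_up_mor comp_assoc[symmetric])
qed

lemma mdot1_cross: "(mdot \<boxtimes> mid [Up]) * cr = cr * (mid [Up] \<boxtimes> mdot) + mid [Up, Up]"
proof -
  have "mdot \<boxtimes> mid [Up] = cr * ((mid [Up] \<boxtimes> mdot) * cr) + cr"
    using neg_add_cancel[of "mdot \<boxtimes> mid [Up]" cr] by (simp add: cross_mdot_cross)
  then show ?thesis
    by (simp add: linear_mor double_up_up_mor comp_assoc)
qed

lemma mdot2_cross: "(mid [Up] \<boxtimes> mdot) * cr = cr * (mdot \<boxtimes> mid [Up]) + - mid [Up, Up]"
  by (simp add: cross_mdot1 add_neg_cancel)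

lemma cross_mdot2: "cr * (mid [Up] \<boxtimes> mdot) = (mdot \<boxtimes> mid [Up]) * cr + - mid [Up, Up]"
  by (simp add: mdot1_cross add_neg_cancel)

section \<open>Dots, curls and circles\<close>

lift_definition mpow :: "nat \<Rightarrow> mor" is dot_pow .

lemma mpow_simps [simp]: "mpow 0 = mid [Up]" "mpow (Suc k) = mdot * mpow k"
  by (transfer, simp add: heq_refl)+

lemma mpow_typing [simp]: "mwf (mpow k)" "msrc (mpow k) = [Up]" "mtgt (mpow k) = [Up]"
  by (induction k) auto

lemma mpow_add: "mpow (i + j) = mpow i * mpow j"
  by (induction i) (auto simp: comp_assoc)

lemma mpow_Suc_right: "mpow (Suc k) = mpow k * mdot"
  using mpow_add[of k 1] by simp

lift_definition circ :: "nat \<Rightarrow> mor" is circle_diag .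

lemma circ_eq: "circ k = ptrace [] (mpow k)"
proof -
  have "circ k = cap Up * ((mpow k \<boxtimes> mid [Down]) * cup Up)"
    by transfer (simp add: circle_diag_def heq_refl)
  then show ?thesis by (simp add: ptrace_def)
qed

lemma circ_typing [simp]: "mwf (circ k)" "msrc (circ k) = []" "mtgt (circ k) = []"
  by (simp_all add: circ_eq)

lemma ptrace_mpow: "mwf g \<Longrightarrow> msrc g = w \<Longrightarrow> mtgt g = w \<Longrightarrow> ptrace w (g \<boxtimes> mpow k) = g \<boxtimes> circ k"
  using ptrace_tens[of "mpow k" "[]" g w] by (simp add: circ_eq)

text \<open>
  In the notation above, \<open>curl k\<close> and \<open>curls p k\<close> are \<open>x\<^sub>2\<^sup>k s\<close> and \<open>x\<^sub>2\<^sup>p s x\<^sub>1\<^sup>k s\<close> with the second strand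
  closed.  The latter interpolates between a circle crossing the strand (\<open>p = 0\<close>) and a circle to its
  right (\<open>k = 0\<close>).
\<close>

definition curl :: "nat \<Rightarrow> mor" where
  "curl k = ptrace [Up] ((mid [Up] \<boxtimes> mpow k) * cr)"

lemma curl_typing [simp]: "mwf (curl k)" "msrc (curl k) = [Up]" "mtgt (curl k) = [Up]"
  by (simp_all add: curl_def)

lemma curl_0: "curl 0 = mdot"
  by (simp add: curl_def mdot_eq)

text \<open>One dot of the loop passes down through the crossing onto the open strand. In the
  correction term the crossing is gone, so the loop closes up to a separate circle.\<close>

lemma curl_Suc: "curl (Suc k) = curl k * mdot + - (mid [Up] \<boxtimes> circ k)"
proof -
  let ?x = "mid [Up] \<boxtimes> mpow k"
  have "(mid [Up] \<boxtimes> mpow (Suc k)) * cr = ?x * ((mid [Up] \<boxtimes> mdot) * cr)"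
    unfolding mpow_Suc_right by (simp add: whisker_left[symmetric] comp_assoc)
  also have "\<dots> = (?x * cr) * (mdot \<boxtimes> mid [Up]) + - ?x"
    by (simp add: mdot2_cross linear_mor comp_assoc)
  finally show ?thesis
    using ptrace_comp_right[of "?x * cr" "[Up]" mdot] ptrace_mpow[of "mid [Up]" "[Up]" k]
    by (simp add: curl_def ptrace_add ptrace_neg)
qed

definition curls :: "nat \<Rightarrow> nat \<Rightarrow> mor" where
  "curls p k = ptrace [Up] ((mid [Up] \<boxtimes> mpow p) * (cr * ((mpow k \<boxtimes> mid [Up]) * cr)))"

lemma curls_typing [simp]: "mwf (curls p k)" "msrc (curls p k) = [Up]" "mtgt (curls p k) = [Up]"
  by (simp_all add: curls_def)

lemma curls_0: "curls p 0 = mid [Up] \<boxtimes> circ p"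
  using ptrace_mpow[of "mid [Up]" "[Up]" p] by (simp add: curls_def double_up_up_mor)

text \<open>One of the dots between the two crossings passes up through the upper crossing. The
  correction term has lost that crossing and is a curl with the remaining \<open>k\<close> dots
  above it on the strand.\<close>

lemma curls_Suc: "curls p (Suc k) = curls (Suc p) k + mpow k * curl p"
proof -
  let ?y = "mid [Up] \<boxtimes> mpow p" and ?x = "mpow k \<boxtimes> mid [Up]"
  have "?y * (cr * ((mpow (Suc k) \<boxtimes> mid [Up]) * cr)) = ?y * ((cr * (mdot \<boxtimes> mid [Up])) * (?x * cr))"
    by (simp add: whisker_right[symmetric] comp_assoc)
  also have "\<dots> = (mid [Up] \<boxtimes> (mpow p * mdot)) * (cr * (?x * cr)) + ?y * (?x * cr)"
    by (simp add: cross_mdot1 linear_mor comp_assoc whisker_left[symmetric])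
  also have "?y * (?x * cr) = ?x * (?y * cr)"
    by (simp add: comp_assoc[symmetric] tens_comp_left tens_comp_right)
  finally show ?thesis
    using ptrace_comp_left[of "?y * cr" "[Up]" "mpow k"]
    by (simp add: curls_def curl_def ptrace_add mpow_Suc_right[symmetric] del: mpow_simps)
qed

text \<open>The descending side of the circle and the strand next to it form
  \<open>[Down, Up]\<close>, whose identity is a double crossing plus a cup-cap term. The cup-cap
  term merges the circle into the strand, leaving its dots there; the other term makes the circle
  overlap the strand.\<close>

lemma circ_slide: "circ k \<boxtimes> mid [Up] = mpow k + curls 0 k"
proof -
  let ?U = "mid [Up]" and ?D = "mid [Down]"
  have "circ k \<boxtimes> ?U = (cap Up \<boxtimes> ?U) * ((mpow k \<boxtimes> mid [Down, Up]) * (cup Up \<boxtimes> ?U))"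
    by (simp add: circ_eq ptrace_def whisker_right[symmetric] tens_assoc)
  also have "mid [Down, Up] = cross Up Down * cross Down Up + cup Down * cap Down"
    by (simp add: double_down_up_mor neg_add_cancel)
  also have "(cap Up \<boxtimes> ?U) * ((mpow k \<boxtimes> (cross Up Down * cross Down Up + cup Down * cap Down)) * (cup Up \<boxtimes> ?U))
    = (cap Up \<boxtimes> ?U) * ((mpow k \<boxtimes> (cross Up Down * cross Down Up)) * (cup Up \<boxtimes> ?U)) +
      (cap Up \<boxtimes> ?U) * ((mpow k \<boxtimes> (cup Down * cap Down)) * (cup Up \<boxtimes> ?U))"
    by (simp add: linear_mor)
  also have "(cap Up \<boxtimes> ?U) * ((mpow k \<boxtimes> (cup Down * cap Down)) * (cup Up \<boxtimes> ?U)) = mpow k"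
  proof -
    have "mpow k \<boxtimes> (cup Down * cap Down) = (?U \<boxtimes> cup Down) * (mpow k * (?U \<boxtimes> cap Down))"
      using interchange[of ?U "mpow k * ?U" "cup Down" "cap Down"] interchange[of "mpow k" ?U "mid []" "cap Down"]
      by simp
    then show ?thesis
      by (simp add: comp_assoc) (simp add: comp_assoc[symmetric])
  qed
  also have "(cap Up \<boxtimes> ?U) * ((mpow k \<boxtimes> (cross Up Down * cross Down Up)) * (cup Up \<boxtimes> ?U)) = curls 0 k"
  proof -
    have "mpow k \<boxtimes> (cross Up Down * cross Down Up)
        = (?U \<boxtimes> cross Up Down) * ((mpow k \<boxtimes> mid [Up, Down]) * (?U \<boxtimes> cross Down Up))"
      by (simp add: interchange)
    then have "(cap Up \<boxtimes> ?U) * ((mpow k \<boxtimes> (cross Up Down * cross Down Up)) * (cup Up \<boxtimes> ?U))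
      = ((cap Up \<boxtimes> ?U) * (?U \<boxtimes> cross Up Down)) * ((mpow k \<boxtimes> mid [Up, Down]) * ((?U \<boxtimes> cross Down Up) * (cup Up \<boxtimes> ?U)))"
      by (simp add: comp_assoc)
    then show ?thesis
      by (simp add: slide_cap_mor slide_cup_mor curls_def ptrace_def whisker_right[symmetric] tens_assoc comp_assoc)
  qed
  finally show ?thesis
    by (simp add: madd_comm)
qed

section \<open>Dots, cycles and circles as morphisms on upward strands\<close>

lemma ups_append [simp]: "ups m @ ups n = ups (m + n)" "ups m @ Up # w = Up # ups m @ w"
  by (simp_all add: replicate_add replicate_app_Cons_same)

abbreviation endo :: "nat \<Rightarrow> mor \<Rightarrow> bool" where
  "endo n f \<equiv> mwf f \<and> msrc f = ups n \<and> mtgt f = ups n"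

lift_definition mdots :: "nat list \<Rightarrow> mor" is dots .
lift_definition mcyc :: "nat \<Rightarrow> mor" is cycle_diag .
lift_definition mcycs :: "nat list \<Rightarrow> mor" is cycles_diag .

lemma mdots_simps [simp]: "mdots [] = mid []" "mdots (i # idx) = mpow i \<boxtimes> mdots idx"
  by (transfer, simp add: heq_refl)+

lemma mcyc_simps [simp]:
  "mcyc 0 = mid []" "mcyc (Suc 0) = mid [Up]"
  "mcyc (Suc (Suc k)) = (cr \<boxtimes> mid (ups k)) * (mid [Up] \<boxtimes> mcyc (Suc k))"
  by (transfer, simp add: heq_refl)+

lemma mcycs_simps [simp]: "mcycs [] = mid []" "mcycs (k # \<pi>) = mcyc k \<boxtimes> mcycs \<pi>"
  by (transfer, simp add: heq_refl)+

lemma mdots_typing [simp]: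
  "mwf (mdots i)" "msrc (mdots i) = ups (length i)" "mtgt (mdots i) = ups (length i)"
  by (induction i) auto

lemma mcyc_typing [simp]: "mwf (mcyc k)" "msrc (mcyc k) = ups k" "mtgt (mcyc k) = ups k"
  using cycle_diag_hom[of k] by (transfer, simp add: hom_def)+

lemma mcycs_typing [simp]:
  "mwf (mcycs \<pi>)" "msrc (mcycs \<pi>) = ups (sum_list \<pi>)" "mtgt (mcycs \<pi>) = ups (sum_list \<pi>)"
  by (induction \<pi>) auto

lemma mdots_append: "mdots (i @ j) = mdots i \<boxtimes> mdots j"
  by (induction i) (auto simp: tens_assoc)

lemma mcycs_append: "mcycs (\<pi> @ \<rho>) = mcycs \<pi> \<boxtimes> mcycs \<rho>"
  by (induction \<pi>) (auto simp: tens_assoc)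

lemma mdots_zero: "mdots (replicate n 0) = mid (ups n)"
  by (induction n) auto

lemma mdots_mult: "length i = length j \<Longrightarrow> mdots i * mdots j = mdots (map2 (+) i j)"
  by (induction i j rule: list_induct2) (auto simp: interchange mpow_add)

lemma sum_list_map2_add: "length i = length j \<Longrightarrow> sum_list (map2 (+) i j) = sum_list i + (sum_list j :: nat)"
  by (induction i j rule: list_induct2) auto

text \<open>The recursion of \<open>cycle_diag\<close> splits off the highest crossing, at the left.
  Closing the last strand requires splitting off the lowest crossing instead, which is the one
  between the last two positions.\<close>

lemma mcyc_Suc_right: "mcyc (Suc (Suc k)) = (mcyc (Suc k) \<boxtimes> mid [Up]) * (mid (ups k) \<boxtimes> cr)"
proof (induction k)
  case (Suc k)
  let ?U = "mid [Up]"
  have "mcyc (Suc (Suc (Suc k))) = (cr \<boxtimes> mid (ups (Suc k))) * (?U \<boxtimes> mcyc (Suc (Suc k)))"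
    by (rule mcyc_simps)
  also have "cr \<boxtimes> mid (ups (Suc k)) = (cr \<boxtimes> mid (ups k)) \<boxtimes> ?U"
    by (simp add: tens_assoc)
  also have "?U \<boxtimes> mcyc (Suc (Suc k)) = ((?U \<boxtimes> mcyc (Suc k)) \<boxtimes> ?U) * (mid (ups (Suc k)) \<boxtimes> cr)"
    by (subst Suc.IH) (simp add: whisker_left[symmetric] tens_assoc tens_id_Cons del: mcyc_simps)
  also have "((cr \<boxtimes> mid (ups k)) \<boxtimes> ?U) * (((?U \<boxtimes> mcyc (Suc k)) \<boxtimes> ?U) * (mid (ups (Suc k)) \<boxtimes> cr))
     = (((cr \<boxtimes> mid (ups k)) * (?U \<boxtimes> mcyc (Suc k))) \<boxtimes> ?U) * (mid (ups (Suc k)) \<boxtimes> cr)"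
    by (simp add: comp_assoc[symmetric] whisker_right del: mcyc_simps)
  finally show ?case by simp
qed simp

text \<open>Circles are endomorphisms of the unit, so juxtaposing and stacking them agree
  (\<open>bub_mult\<close>); a list of dot numbers thus encodes a monomial in the negated
  circles.\<close>

fun bub :: "nat list \<Rightarrow> mor" where
  "bub [] = mid []"
| "bub (k # ks) = (- circ k) \<boxtimes> bub ks"

lemma bub_typing [simp]: "mwf (bub ks)" "msrc (bub ks) = []" "mtgt (bub ks) = []"
  by (induction ks) auto

lemma bub_append: "bub (ks @ ls) = bub ks \<boxtimes> bub ls"
  by (induction ks) (auto simp: tens_assoc)

lemma bub_mult: "bub ks * bub ls = bub (ks @ ls)"
  using tens_comp_left[of "bub ks" "bub ls" "[]" "[]"] by (simp add: bub_append)

section \<open>Cones of dotted strands and cycles\<close>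

text \<open>
  All sums that occur are non-empty, so the zero morphisms, which depend on source and target, are
  not needed.
\<close>

inductive_set nonneg_sum :: "mor set \<Rightarrow> mor set" for B where
  nonneg_sum_base: "f \<in> B \<Longrightarrow> f \<in> nonneg_sum B"
| nonneg_sum_add: "f \<in> nonneg_sum B \<Longrightarrow> g \<in> nonneg_sum B \<Longrightarrow> f + g \<in> nonneg_sum B"

lemma nonneg_sum_endo: "f \<in> nonneg_sum B \<Longrightarrow> (\<And>b. b \<in> B \<Longrightarrow> endo n b) \<Longrightarrow> endo n f"
  by (induction rule: nonneg_sum.induct) auto

text \<open>Additivity of \<open>h\<close> is demanded on the cone only, since composition and
  tensor product distribute over sums under typing conditions.\<close>

lemma nonneg_sum_map:
  assumes "f \<in> nonneg_sum B" "\<And>b. b \<in> B \<Longrightarrow> h b \<in> nonneg_sum B'"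
    "\<And>f g. f \<in> nonneg_sum B \<Longrightarrow> g \<in> nonneg_sum B \<Longrightarrow> h (f + g) = h f + h g"
  shows "h f \<in> nonneg_sum B'"
  using assms(1) by induction (auto simp: assms intro: nonneg_sum_add)

lemma nonneg_sum_mono: "B \<subseteq> B' \<Longrightarrow> f \<in> nonneg_sum B \<Longrightarrow> f \<in> nonneg_sum B'"
  by (erule nonneg_sum_map[where h = "\<lambda>f. f"]) (auto intro: nonneg_sum_base)

section \<open>Crossing-free cones: moving circles from right to left\<close>

definition dot_basis :: "nat \<Rightarrow> nat \<Rightarrow> mor set" where
  "dot_basis n d = {bub ks \<boxtimes> mdots i | ks i. length i = n \<and> sum_list ks + sum_list i \<le> d}"

abbreviation "dot_cone n d \<equiv> nonneg_sum (dot_basis n d)"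

lemma dot_coneI: "length i = n \<Longrightarrow> sum_list ks + sum_list i \<le> d \<Longrightarrow> bub ks \<boxtimes> mdots i \<in> dot_cone n d"
  by (auto simp: dot_basis_def intro: nonneg_sum_base)

lemma dot_cone_endo: "f \<in> dot_cone n d \<Longrightarrow> endo n f"
  by (erule nonneg_sum_endo) (auto simp: dot_basis_def)

lemma dot_cone_mono: "f \<in> dot_cone n d \<Longrightarrow> d \<le> e \<Longrightarrow> f \<in> dot_cone n e"
  by (erule nonneg_sum_mono[rotated]) (fastforce simp: dot_basis_def)

lemma dot_cone_mult:
  assumes "f \<in> dot_cone n d" "g \<in> dot_cone n e"
  shows "f * g \<in> dot_cone n (d + e)"
  using assms(1)
proof (rule nonneg_sum_map[where h = "\<lambda>f. f * g"])
  fix b assume b: "b \<in> dot_basis n d"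
  then have endo: "endo n b" by (rule dot_cone_endo[OF nonneg_sum_base])
  from assms(2) show "b * g \<in> dot_cone n (d + e)"
  proof (rule nonneg_sum_map[where h = "\<lambda>g. b * g"])
    fix c assume c: "c \<in> dot_basis n e"
    from b obtain ks i where b': "b = bub ks \<boxtimes> mdots i" "length i = n" "sum_list ks + sum_list i \<le> d"
      by (auto simp: dot_basis_def)
    from c obtain ls j where c': "c = bub ls \<boxtimes> mdots j" "length j = n" "sum_list ls + sum_list j \<le> e"
      by (auto simp: dot_basis_def)
    have "b * c = bub (ks @ ls) \<boxtimes> mdots (map2 (+) i j)"
      using b' c' by (simp add: interchange bub_mult mdots_mult)
    then show "b * c \<in> dot_cone n (d + e)"
      using b' c' by (auto intro!: dot_coneI simp: sum_list_map2_add)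
  qed (use endo in \<open>auto dest!: dot_cone_endo simp: comp_add_right\<close>)
qed (use assms(2) in \<open>auto dest!: dot_cone_endo simp: comp_add_left\<close>)

lemma dot_cone_strand:
  assumes "f \<in> dot_cone n d"
  shows "f \<boxtimes> mid [Up] \<in> dot_cone (Suc n) d"
  using assms
proof (rule nonneg_sum_map[where h = "\<lambda>f. f \<boxtimes> mid [Up]"])
  fix b assume "b \<in> dot_basis n d"
  then obtain ks i where b: "b = bub ks \<boxtimes> mdots i" "length i = n" "sum_list ks + sum_list i \<le> d"
    by (auto simp: dot_basis_def)
  have "b \<boxtimes> mid [Up] = bub ks \<boxtimes> mdots (i @ [0])"
    by (simp add: b mdots_append tens_assoc)
  then show "b \<boxtimes> mid [Up] \<in> dot_cone (Suc n) d"
    using b by (auto intro!: dot_coneI)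
qed (auto dest!: dot_cone_endo simp: tens_add_left)

lemma mpow_in_dot_cone: "mid (ups n) \<boxtimes> mpow k \<in> dot_cone (Suc n) k"
  using dot_coneI[of "replicate n 0 @ [k]" "Suc n" "[]" k]
  by (simp add: mdots_append mdots_zero sum_list_replicate)

text \<open>Unfolding with \<open>curl_Suc\<close> gives dots and negated circles to the right of
  all strands. These circles carry fewer than \<open>p\<close> dots, so the hypothesis can serve as
  an induction hypothesis in \<open>circ_in_dot_cone\<close>.\<close>

lemma curl_in_dot_cone:
  assumes "\<And>a. a < p \<Longrightarrow> - (mid (ups (Suc n)) \<boxtimes> circ a) \<in> dot_cone (Suc n) a"
  shows "mid (ups n) \<boxtimes> curl p \<in> dot_cone (Suc n) (Suc p)"
  using assms
proof (induction p)
  case 0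
  then show ?case using mpow_in_dot_cone[of n 1] by (simp add: curl_0)
next
  case (Suc p)
  have "mid (ups n) \<boxtimes> curl (Suc p)
      = (mid (ups n) \<boxtimes> curl p) * (mid (ups n) \<boxtimes> mpow 1) + - (mid (ups (Suc n)) \<boxtimes> circ p)"
    using tens_assoc[of "mid (ups n)" "mid [Up]" "circ p"]
    by (simp add: curl_Suc linear_mor whisker_left)
  moreover have "(mid (ups n) \<boxtimes> curl p) * (mid (ups n) \<boxtimes> mpow 1) \<in> dot_cone (Suc n) (Suc p + 1)"
    using Suc by (intro dot_cone_mult mpow_in_dot_cone) auto
  moreover have "- (mid (ups (Suc n)) \<boxtimes> circ p) \<in> dot_cone (Suc n) (Suc p + 1)"
    using Suc.prems[of p] by (rule dot_cone_mono) auto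
  ultimately show ?case by (auto intro: nonneg_sum_add)
qed

text \<open>\<open>curls_Suc\<close> shifts dots one by one from the second argument to the first,
  ending with the circle on the right. Under negation each shift adds a power of the dot times a
  curl, with a plus sign and within the degree bound.\<close>

lemma curls_dot_cone:
  assumes "\<And>a. a < p + k \<Longrightarrow> - (mid (ups (Suc n)) \<boxtimes> circ a) \<in> dot_cone (Suc n) a"
    and "- (mid (ups n) \<boxtimes> curls p k) \<in> dot_cone (Suc n) (p + k)"
  shows "- (mid (ups (Suc n)) \<boxtimes> circ (p + k)) \<in> dot_cone (Suc n) (p + k)"
  using assms
proof (induction k arbitrary: p)
  case 0
  then show ?case
    using tens_assoc[of "mid (ups n)" "mid [Up]" "circ p"] by (simp add: curls_0)
next
  case (Suc k)
  have "- (mid (ups n) \<boxtimes> curls (Suc p) k)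
      = - (mid (ups n) \<boxtimes> curls p (Suc k)) + (mid (ups n) \<boxtimes> mpow k) * (mid (ups n) \<boxtimes> curl p)"
    by (simp add: curls_Suc linear_mor whisker_left neg_add_cancel)
  moreover have "(mid (ups n) \<boxtimes> mpow k) * (mid (ups n) \<boxtimes> curl p) \<in> dot_cone (Suc n) (k + Suc p)"
    using Suc.prems(1) by (intro dot_cone_mult mpow_in_dot_cone curl_in_dot_cone) auto
  ultimately have "- (mid (ups n) \<boxtimes> curls (Suc p) k) \<in> dot_cone (Suc n) (Suc p + k)"
    using Suc.prems(2) by (auto intro!: nonneg_sum_add simp: add.commute)
  then show ?case
    using Suc.IH[of "Suc p"] Suc.prems(1) by auto
qed

text \<open>The outer induction moves the circle past one strand after another, the inner one is on
  its number of dots. Solved for \<open>- curls 0 k\<close>, \<open>circ_slide\<close> expresses it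
  through the negated circle left of the last strand and dots, both with a plus sign;
  \<open>curls_dot_cone\<close> does the rest.\<close>

lemma circ_in_dot_cone: "- (mid (ups n) \<boxtimes> circ k) \<in> dot_cone n k"
proof (induction n arbitrary: k)
  case 0
  show ?case using dot_coneI[of "[]" 0 "[k]" k] by simp
next
  case (Suc n)
  show ?case
  proof (induction k rule: less_induct)
    case (less k)
    have "- (mid (ups n) \<boxtimes> curls 0 k)
        = (- (mid (ups n) \<boxtimes> circ k)) \<boxtimes> mid [Up] + mid (ups n) \<boxtimes> mpow k"
    proof -
      have "- curls 0 k = - (circ k \<boxtimes> mid [Up]) + mpow k"
        using neg_add_cancel[of "- curls 0 k" "mpow k"]
        by (simp add: circ_slide linear_mor madd_comm[of "- mpow k"])
      then have "mid (ups n) \<boxtimes> (- curls 0 k) = mid (ups n) \<boxtimes> (- (circ k \<boxtimes> mid [Up]) + mpow k)"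
        by simp
      then show ?thesis by (simp add: linear_mor tens_assoc)
    qed
    moreover have "\<dots> \<in> dot_cone (Suc n) k"
      by (intro nonneg_sum_add dot_cone_strand Suc.IH mpow_in_dot_cone)
    ultimately show ?case
      using curls_dot_cone[of 0 k n] less by auto
  qed
qed

section \<open>Signed cones of dotted cycles\<close>

definition signed :: "nat \<Rightarrow> mor \<Rightarrow> mor" where
  "signed l f = (if even l then f else - f)"

lemma signed_typing [simp]: "mwf (signed l f) = mwf f" "msrc (signed l f) = msrc f" "mtgt (signed l f) = mtgt f"
  by (auto simp: signed_def)

lemma signed_0 [simp]: "signed 0 f = f"
  by (simp add: signed_def)

lemma signed_Suc: "mwf f \<Longrightarrow> signed (Suc l) f = - signed l f"
  by (auto simp: signed_def neg_neg_mor)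

lemma signed_tens: "mwf f \<Longrightarrow> mwf g \<Longrightarrow> signed l f \<boxtimes> signed m g = signed (l + m) (f \<boxtimes> g)"
  by (auto simp: signed_def linear_mor)

lemma signed_comp_right: "mwf (g * f) \<Longrightarrow> g * signed l f = signed l (g * f)"
  by (auto simp: signed_def linear_mor)

lemma signed_comp_left: "mwf (g * f) \<Longrightarrow> signed l g * f = signed l (g * f)"
  by (auto simp: signed_def linear_mor)

lemma signed_tens_left: "mwf f \<Longrightarrow> mwf g \<Longrightarrow> signed l f \<boxtimes> g = signed l (f \<boxtimes> g)"
  by (auto simp: signed_def linear_mor)

text \<open>The bound says \<open>n - length \<pi> + sum_list i \<le> d\<close>.\<close>

definition cyc_basis :: "nat \<Rightarrow> nat \<Rightarrow> mor set" where
  "cyc_basis n d = {signed (length \<pi>) (mdots i * mcycs \<pi>) | \<pi> i.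
     length i = n \<and> sum_list \<pi> = n \<and> 0 \<notin> set \<pi> \<and> n + sum_list i \<le> d + length \<pi>}"

abbreviation "cyc_cone n d \<equiv> nonneg_sum (cyc_basis n d)"

lemma cyc_basisI:
  "length i = n \<Longrightarrow> sum_list \<pi> = n \<Longrightarrow> 0 \<notin> set \<pi> \<Longrightarrow> n + sum_list i \<le> d + length \<pi> \<Longrightarrow>
    signed (length \<pi>) (mdots i * mcycs \<pi>) \<in> cyc_basis n d"
  by (auto simp: cyc_basis_def)

lemma cyc_basisE:
  assumes "f \<in> cyc_basis n d"
  obtains \<pi> i where "f = signed (length \<pi>) (mdots i * mcycs \<pi>)" "length i = n" "sum_list \<pi> = n"
    "0 \<notin> set \<pi>" "n + sum_list i \<le> d + length \<pi>"
  using assms by (auto simp: cyc_basis_def)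

text \<open>Isolates the last cycle and the dots on the last strand. As \<pi> now lists the other
  cycles only, both sides of the degree bound have dropped by one.\<close>

lemma cyc_basis_SucE:
  assumes "f \<in> cyc_basis (Suc n) d"
  obtains \<pi> k i b where "f = signed (Suc (length \<pi>)) (mdots (i @ [b]) * (mcycs \<pi> \<boxtimes> mcyc (Suc k)))"
    "length i = n" "sum_list \<pi> + k = n" "0 \<notin> set \<pi>" "n + sum_list i + b \<le> d + length \<pi>"
proof -
  from assms obtain \<rho> j where f: "f = signed (length \<rho>) (mdots j * mcycs \<rho>)" "length j = Suc n"
    "sum_list \<rho> = Suc n" "0 \<notin> set \<rho>" "Suc n + sum_list j \<le> d + length \<rho>"
    by (rule cyc_basisE)
  obtain \<pi> m where \<rho>: "\<rho> = \<pi> @ [m]" using f(3) by (cases \<rho> rule: rev_cases) auto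
  obtain k where m: "m = Suc k" using f(4) \<rho> by (cases m) auto
  obtain i b where j: "j = i @ [b]" using f(2) by (cases j rule: rev_cases) auto
  have "mcycs \<rho> = mcycs \<pi> \<boxtimes> mcyc (Suc k)"
    by (simp add: \<rho> m mcycs_append del: mcyc_simps)
  with f show ?thesis
    by (intro that[of \<pi> i b k]) (auto simp: \<rho> m j)
qed

lemma cyc_cone_endo: "f \<in> cyc_cone n d \<Longrightarrow> endo n f"
  by (erule nonneg_sum_endo) (auto simp: cyc_basis_def)

lemma cyc_cone_mono: "f \<in> cyc_cone n d \<Longrightarrow> d \<le> e \<Longrightarrow> f \<in> cyc_cone n e"
  by (erule nonneg_sum_mono[rotated]) (fastforce simp: cyc_basis_def)

lemma cyc_cone_tens:
  assumes "f \<in> cyc_cone m d" "g \<in> cyc_cone n e"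
  shows "f \<boxtimes> g \<in> cyc_cone (m + n) (d + e)"
  using assms(1)
proof (rule nonneg_sum_map[where h = "\<lambda>f. f \<boxtimes> g"])
  fix b assume b: "b \<in> cyc_basis m d"
  then have endo: "endo m b" by (rule cyc_cone_endo[OF nonneg_sum_base])
  from assms(2) show "b \<boxtimes> g \<in> cyc_cone (m + n) (d + e)"
  proof (rule nonneg_sum_map[where h = "\<lambda>g. b \<boxtimes> g"])
    fix c assume c: "c \<in> cyc_basis n e"
    from b obtain \<pi> i where b': "b = signed (length \<pi>) (mdots i * mcycs \<pi>)" "length i = m"
      "sum_list \<pi> = m" "0 \<notin> set \<pi>" "m + sum_list i \<le> d + length \<pi>"
      by (rule cyc_basisE)
    from c obtain \<rho> j where c': "c = signed (length \<rho>) (mdots j * mcycs \<rho>)" "length j = n"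
      "sum_list \<rho> = n" "0 \<notin> set \<rho>" "n + sum_list j \<le> e + length \<rho>"
      by (rule cyc_basisE)
    have "b \<boxtimes> c = signed (length (\<pi> @ \<rho>)) (mdots (i @ j) * mcycs (\<pi> @ \<rho>))"
      using b' c' by (simp add: signed_tens interchange mdots_append mcycs_append)
    also have "\<dots> \<in> cyc_cone (m + n) (d + e)"
      using b' c' by (intro nonneg_sum_base cyc_basisI) auto
    finally show "b \<boxtimes> c \<in> cyc_cone (m + n) (d + e)" .
  qed (use endo in \<open>auto dest!: cyc_cone_endo simp: tens_add_right\<close>)
qed (use assms(2) in \<open>auto dest!: cyc_cone_endo simp: tens_add_left\<close>)

lemma cyc_basis_mdots:
  assumes "f \<in> cyc_basis n d" "length j = n"
  shows "mdots j * f \<in> cyc_basis n (d + sum_list j)"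
proof -
  from assms(1) obtain \<pi> i where b: "f = signed (length \<pi>) (mdots i * mcycs \<pi>)" "length i = n"
    "sum_list \<pi> = n" "0 \<notin> set \<pi>" "n + sum_list i \<le> d + length \<pi>"
    by (rule cyc_basisE)
  have "mdots j * f = signed (length \<pi>) (mdots (map2 (+) j i) * mcycs \<pi>)"
    using b assms(2) by (simp add: signed_comp_right mdots_mult[symmetric] comp_assoc)
  also have "\<dots> \<in> cyc_basis n (d + sum_list j)"
    using b assms(2) by (intro cyc_basisI) (auto simp: sum_list_map2_add)
  finally show ?thesis .
qed

lemma cyc_cone_mdots:
  assumes "f \<in> cyc_cone n d" "length j = n"
  shows "mdots j * f \<in> cyc_cone n (d + sum_list j)"
  using assms(1)
  by (rule nonneg_sum_map[where h = "\<lambda>f. mdots j * f"])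
    (use assms(2) in \<open>auto dest!: cyc_cone_endo intro: nonneg_sum_base cyc_basis_mdots simp: comp_add_right\<close>)

lemma mid_ups_add: "mwf f \<Longrightarrow> mid (ups (m + n)) \<boxtimes> f = mid (ups m) \<boxtimes> (mid (ups n) \<boxtimes> f)"
  using tens_assoc[of "mid (ups m)" "mid (ups n)" f] by simp

text \<open>By \<open>mcyc_Suc_right\<close> the crossing lengthens the last cycle by one strand.
  The number of cycles stays, so the sign is kept and the degree grows by one.\<close>

lemma cyc_cone_cross:
  assumes "f \<in> cyc_cone (Suc n) d"
  shows "(f \<boxtimes> mid [Up]) * (mid (ups n) \<boxtimes> cr) \<in> cyc_cone (Suc (Suc n)) (Suc d)"
  using assms
proof (rule nonneg_sum_map[where h = "\<lambda>f. (f \<boxtimes> mid [Up]) * (mid (ups n) \<boxtimes> cr)"])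
  fix f assume "f \<in> cyc_basis (Suc n) d"
  then obtain \<pi> k i b where f: "f = signed (Suc (length \<pi>)) (mdots (i @ [b]) * (mcycs \<pi> \<boxtimes> mcyc (Suc k)))"
    "length i = n" "sum_list \<pi> + k = n" "0 \<notin> set \<pi>" "n + sum_list i + b \<le> d + length \<pi>"
    by (rule cyc_basis_SucE)
  let ?M = "mcyc (Suc k)"
  have "(mcycs \<pi> \<boxtimes> (?M \<boxtimes> mid [Up])) * (mid (ups n) \<boxtimes> cr)
      = mcycs \<pi> \<boxtimes> mcyc (Suc (Suc k))"
    using mid_ups_add[of cr "sum_list \<pi>" k] f(3)
    by (simp add: interchange mcyc_Suc_right del: mcyc_simps)
  moreover have "(mdots (i @ [b]) * (mcycs \<pi> \<boxtimes> ?M)) \<boxtimes> mid [Up]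
      = mdots (i @ [b, 0]) * (mcycs \<pi> \<boxtimes> (?M \<boxtimes> mid [Up]))"
    using f(2,3) by (simp add: whisker_right[symmetric] mdots_append tens_assoc del: mcyc_simps)
  ultimately have "(f \<boxtimes> mid [Up]) * (mid (ups n) \<boxtimes> cr)
      = signed (length (\<pi> @ [Suc (Suc k)])) (mdots (i @ [b, 0]) * mcycs (\<pi> @ [Suc (Suc k)]))"
    using f(2,3) by (simp add: f(1) signed_tens_left signed_comp_left comp_assoc mcycs_append del: mcyc_simps)
  also have "\<dots> \<in> cyc_cone (Suc (Suc n)) (Suc d)"
    using f by (intro nonneg_sum_base cyc_basisI) auto
  finally show "(f \<boxtimes> mid [Up]) * (mid (ups n) \<boxtimes> cr) \<in> cyc_cone (Suc (Suc n)) (Suc d)" .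
qed (auto dest!: cyc_cone_endo simp: tens_add_left comp_add_left)

lemma mcyc_in_cyc_basis: "- mcyc (Suc k) \<in> cyc_basis (Suc k) k"
  using cyc_basisI[of "replicate (Suc k) 0" "Suc k" "[Suc k]" k]
  unfolding mdots_zero by (simp add: signed_def sum_list_replicate del: mcyc_simps mdots_simps)

text \<open>The dot climbs the last strand through the crossings of the cycle. Each correction term
  from \<open>cross_mdot2\<close> lacks one crossing, and there the cycle falls apart into
  two.\<close>

lemma mcyc_mdot_in_cyc_cone: "- (mcyc (Suc k) * (mid (ups k) \<boxtimes> mdot)) \<in> cyc_cone (Suc k) (Suc k)"
proof (induction k)
  case 0
  show ?case
    using cyc_basisI[of "[1]" 1 "[1]" 1] by (auto intro!: nonneg_sum_base simp: signed_def)
next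
  case (Suc k)
  let ?U = "mid [Up]" and ?M = "mcyc (Suc k)"
  have "mid (ups (Suc k)) \<boxtimes> mdot = mid (ups k) \<boxtimes> (?U \<boxtimes> mdot)"
    using tens_assoc[of "mid (ups k)" ?U mdot] by simp
  then have "mcyc (Suc (Suc k)) * (mid (ups (Suc k)) \<boxtimes> mdot)
      = (?M \<boxtimes> ?U) * (mid (ups k) \<boxtimes> (cr * (?U \<boxtimes> mdot)))"
    by (simp add: mcyc_Suc_right comp_assoc whisker_left del: mcyc_simps)
  also have "\<dots> = (?M \<boxtimes> ?U) * (mid (ups k) \<boxtimes> ((mdot \<boxtimes> ?U) * cr)) + - (?M \<boxtimes> ?U)"
    by (simp add: cross_mdot2 linear_mor del: mcyc_simps)
  also have "(?M \<boxtimes> ?U) * (mid (ups k) \<boxtimes> ((mdot \<boxtimes> ?U) * cr)) = ((?M * (mid (ups k) \<boxtimes> mdot)) \<boxtimes> ?U) * (mid (ups k) \<boxtimes> cr)"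
    by (simp add: whisker_left[symmetric] whisker_right[symmetric] tens_assoc comp_assoc del: mcyc_simps)
  \<comment> \<open>The correction now has a plus sign, which is the sign belonging to two cycles:
    one minus for \<open>?M\<close> and one for the split-off trivial cycle.\<close>
  finally have "- (mcyc (Suc (Suc k)) * (mid (ups (Suc k)) \<boxtimes> mdot))
      = ((- (?M * (mid (ups k) \<boxtimes> mdot))) \<boxtimes> ?U) * (mid (ups k) \<boxtimes> cr) + (- ?M) \<boxtimes> (- mcyc 1)"
    by (simp add: linear_mor del: mcyc_simps(3))
  also have "\<dots> \<in> cyc_cone (Suc (Suc k)) (Suc (Suc k))"
  proof (rule nonneg_sum_add)
    have "(- ?M) \<boxtimes> (- mcyc 1) \<in> cyc_cone (Suc k + 1) (k + 0)"
      using mcyc_in_cyc_basis[of k] mcyc_in_cyc_basis[of 0] by (intro cyc_cone_tens nonneg_sum_base) auto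
    then show "(- ?M) \<boxtimes> (- mcyc 1) \<in> cyc_cone (Suc (Suc k)) (Suc (Suc k))"
      by (auto elim: cyc_cone_mono)
  qed (rule cyc_cone_cross[OF Suc.IH])
  finally show ?case .
qed

text \<open>Every part is at least 1. This keeps the truncated subtractions in the degree bounds
  exact.\<close>

lemma length_le_sum_list: "0 \<notin> set \<pi> \<Longrightarrow> length \<pi> \<le> sum_list (\<pi> :: nat list)"
  by (induction \<pi>) auto

lemma cyc_cone_mdot_right:
  assumes "f \<in> cyc_cone (Suc n) d"
  shows "f * (mid (ups n) \<boxtimes> mdot) \<in> cyc_cone (Suc n) (Suc d)"
  using assms
proof (rule nonneg_sum_map[where h = "\<lambda>f. f * (mid (ups n) \<boxtimes> mdot)"])
  fix f assume "f \<in> cyc_basis (Suc n) d"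
  then obtain \<pi> k i b where f: "f = signed (Suc (length \<pi>)) (mdots (i @ [b]) * (mcycs \<pi> \<boxtimes> mcyc (Suc k)))"
    "length i = n" "sum_list \<pi> + k = n" "0 \<notin> set \<pi>" "n + sum_list i + b \<le> d + length \<pi>"
    by (rule cyc_basis_SucE)
  \<comment> \<open>\<open>?A\<close> consists of the other cycles stripped of their dots, so that
    the tensor product of cones applies; all dots are put back on top by
    \<open>cyc_cone_mdots\<close>.\<close>
  let ?M = "mcyc (Suc k)" and ?A = "signed (length \<pi>) (mdots (replicate (sum_list \<pi>) 0) * mcycs \<pi>)"
  have "(mcycs \<pi> \<boxtimes> ?M) * (mid (ups n) \<boxtimes> mdot) = mcycs \<pi> \<boxtimes> (?M * (mid (ups k) \<boxtimes> mdot))"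
    using mid_ups_add[of mdot "sum_list \<pi>" k] f(3) by (simp add: interchange del: mcyc_simps)
  then have "f * (mid (ups n) \<boxtimes> mdot)
      = mdots (i @ [b]) * (?A \<boxtimes> (- (?M * (mid (ups k) \<boxtimes> mdot))))"
    using f(2,3) unfolding f(1)
    by (simp add: mdots_zero signed_comp_left signed_comp_right comp_assoc signed_Suc linear_mor signed_tens_left del: mcyc_simps)
  also have "?A \<boxtimes> (- (?M * (mid (ups k) \<boxtimes> mdot))) \<in> cyc_cone (sum_list \<pi> + Suc k) (sum_list \<pi> - length \<pi> + Suc k)"
    using f length_le_sum_list[of \<pi>]
    by (intro cyc_cone_tens mcyc_mdot_in_cyc_cone nonneg_sum_base cyc_basisI) (auto simp: sum_list_replicate)
  then have "mdots (i @ [b]) * (?A \<boxtimes> (- (?M * (mid (ups k) \<boxtimes> mdot))))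
     \<in> cyc_cone (sum_list \<pi> + Suc k) (sum_list \<pi> - length \<pi> + Suc k + sum_list (i @ [b]))"
    using f by (intro cyc_cone_mdots) auto
  then have "mdots (i @ [b]) * (?A \<boxtimes> (- (?M * (mid (ups k) \<boxtimes> mdot)))) \<in> cyc_cone (Suc n) (Suc d)"
    using f(3,5) length_le_sum_list[OF f(4)] by (auto elim!: cyc_cone_mono)
  finally show "f * (mid (ups n) \<boxtimes> mdot) \<in> cyc_cone (Suc n) (Suc d)" .
qed (auto dest!: cyc_cone_endo simp: comp_add_left)

section \<open>The full cones: circles, dots and cycles\<close>

definition basis :: "nat \<Rightarrow> nat \<Rightarrow> mor set" where
  "basis n d = {bub ks \<boxtimes> f | ks f e. f \<in> cyc_basis n e \<and> sum_list ks + e \<le> d}"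

abbreviation "cone n d \<equiv> nonneg_sum (basis n d)"

lemma cyc_basis_endo: "f \<in> cyc_basis n d \<Longrightarrow> endo n f"
  by (rule cyc_cone_endo[OF nonneg_sum_base])

lemma cone_endo: "f \<in> cone n d \<Longrightarrow> endo n f"
  by (erule nonneg_sum_endo) (auto simp: basis_def dest: cyc_basis_endo)

lemma cone_mono: "f \<in> cone n d \<Longrightarrow> d \<le> e \<Longrightarrow> f \<in> cone n e"
  by (erule nonneg_sum_mono[rotated]) (fastforce simp: basis_def)

lemma bub_cone:
  assumes "f \<in> cone n d"
  shows "bub ks \<boxtimes> f \<in> cone n (sum_list ks + d)"
  using assms
proof (rule nonneg_sum_map[where h = "\<lambda>f. bub ks \<boxtimes> f"])
  fix b assume "b \<in> basis n d"
  then obtain ls f e where b: "b = bub ls \<boxtimes> f" "f \<in> cyc_basis n e" "sum_list ls + e \<le> d"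
    by (auto simp: basis_def)
  have "bub ks \<boxtimes> b = bub (ks @ ls) \<boxtimes> f"
    using cyc_basis_endo[OF b(2)] by (simp add: b(1) bub_append tens_assoc)
  then show "bub ks \<boxtimes> b \<in> cone n (sum_list ks + d)"
    using b by (auto intro!: nonneg_sum_base simp: basis_def) (metis add.assoc add_left_mono sum_list_append)
qed (auto dest!: cone_endo simp: tens_add_right)

lemma cyc_cone_subset: "f \<in> cyc_cone n d \<Longrightarrow> f \<in> cone n d"
proof (erule nonneg_sum_mono[rotated], rule subsetI)
  fix f assume f: "f \<in> cyc_basis n d"
  then have "f = bub [] \<boxtimes> f" by (simp add: cyc_basis_endo)
  with f show "f \<in> basis n d" unfolding basis_def
    by (intro CollectI exI[of _ "[]"] exI[of _ f] exI[of _ d]) auto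
qed

text \<open>Basis elements carry their dots above the cycles, so dots multiplied from above simply
  join them without passing a crossing.\<close>

lemma dot_cone_mult_cone:
  assumes "g \<in> dot_cone n d" "f \<in> cone n e"
  shows "g * f \<in> cone n (d + e)"
  using assms(1)
proof (rule nonneg_sum_map[where h = "\<lambda>g. g * f"])
  fix b assume b: "b \<in> dot_basis n d"
  then have endo: "endo n b" by (rule dot_cone_endo[OF nonneg_sum_base])
  from assms(2) show "b * f \<in> cone n (d + e)"
  proof (rule nonneg_sum_map[where h = "\<lambda>f. b * f"])
    fix c assume "c \<in> basis n e"
    then obtain ls f m where c: "c = bub ls \<boxtimes> f" "f \<in> cyc_basis n m" "sum_list ls + m \<le> e"
      by (auto simp: basis_def)
    from b obtain ks i where b': "b = bub ks \<boxtimes> mdots i" "length i = n" "sum_list ks + sum_list i \<le> d"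
      by (auto simp: dot_basis_def)
    have "b * c = bub (ks @ ls) \<boxtimes> (mdots i * f)"
      using cyc_basis_endo[OF c(2)] b'(2) by (simp add: b'(1) c(1) interchange bub_mult)
    also have "\<dots> \<in> cone n (sum_list (ks @ ls) + (m + sum_list i))"
      by (intro bub_cone cyc_cone_subset nonneg_sum_base cyc_basis_mdots c b')
    finally show "b * c \<in> cone n (d + e)"
      by (rule cone_mono) (use b' c in auto)
  qed (use endo in \<open>auto dest!: cone_endo simp: comp_add_right\<close>)
qed (use assms(2) in \<open>auto dest!: dot_cone_endo cone_endo simp: comp_add_left\<close>)

text \<open>By interchange the circle is raised above \<open>f\<close>, where
  \<open>circ_in_dot_cone\<close> moves it to the left.\<close>

lemma cone_circ:
  assumes "f \<in> cone n d"
  shows "- (f \<boxtimes> circ a) \<in> cone n (d + a)"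
proof -
  have "- (f \<boxtimes> circ a) = - (mid (ups n) \<boxtimes> circ a) * f"
    using cone_endo[OF assms] tens_comp_right[of f "circ a" "ups n" "[]"]
    by (simp add: linear_mor)
  with dot_cone_mult_cone[OF circ_in_dot_cone assms] show ?thesis
    by (simp add: add.commute)
qed

lemma cone_mdot:
  assumes "f \<in> cone (Suc n) d"
  shows "f * (mid (ups n) \<boxtimes> mdot) \<in> cone (Suc n) (Suc d)"
  using assms
proof (rule nonneg_sum_map[where h = "\<lambda>f. f * (mid (ups n) \<boxtimes> mdot)"])
  fix b assume "b \<in> basis (Suc n) d"
  then obtain ks f e where b: "b = bub ks \<boxtimes> f" "f \<in> cyc_basis (Suc n) e" "sum_list ks + e \<le> d"
    by (auto simp: basis_def)
  have "b * (mid (ups n) \<boxtimes> mdot) = bub ks \<boxtimes> (f * (mid (ups n) \<boxtimes> mdot))"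
    using cyc_basis_endo[OF b(2)] interchange[of "bub ks" "mid []" f "mid (ups n) \<boxtimes> mdot"]
    by (simp add: b(1))
  also have "\<dots> \<in> cone (Suc n) (sum_list ks + Suc e)"
    by (intro bub_cone cyc_cone_subset cyc_cone_mdot_right nonneg_sum_base b)
  finally show "b * (mid (ups n) \<boxtimes> mdot) \<in> cone (Suc n) (Suc d)"
    by (rule cone_mono) (use b in auto)
qed (auto dest!: cone_endo simp: comp_add_left)

text \<open>Induction along \<open>curl_Suc\<close>, with \<open>cone_mdot\<close> for the dot below
  and \<open>cone_circ\<close> for the circle. The curl counts as \<open>k + 1\<close> because
  \<open>curl 0\<close> is a dot.\<close>

lemma cone_curl:
  assumes "f \<in> cone (Suc n) d"
  shows "f * (mid (ups n) \<boxtimes> curl k) \<in> cone (Suc n) (Suc (d + k))"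
proof (induction k)
  case 0
  show ?case using cone_mdot[OF assms] by (simp add: curl_0)
next
  case (Suc k)
  have f: "endo (Suc n) f" by (rule cone_endo[OF assms])
  have "f * (mid (ups n) \<boxtimes> (mid [Up] \<boxtimes> circ k)) = f \<boxtimes> circ k"
    using f tens_assoc[of "mid (ups n)" "mid [Up]" "circ k"]
      tens_comp_left[of f "circ k" "ups (Suc n)" "[]"] by simp
  then have "f * (mid (ups n) \<boxtimes> curl (Suc k))
      = (f * (mid (ups n) \<boxtimes> curl k)) * (mid (ups n) \<boxtimes> mdot) + - (f \<boxtimes> circ k)"
    using f by (simp add: curl_Suc linear_mor whisker_left[symmetric] comp_assoc)
  also have "\<dots> \<in> cone (Suc n) (Suc (d + Suc k))"
    using cone_mdot[OF Suc.IH] cone_mono[OF cone_circ[OF assms, of k]] by (auto intro!: nonneg_sum_add)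
  finally show ?case .
qed

lemma ptrace_cyc_basis:
  assumes "f \<in> cyc_basis (Suc n) d"
  shows "ptrace (ups n) f \<in> cone n d"
proof -
  from assms obtain \<pi> k i b where f: "f = signed (Suc (length \<pi>)) (mdots (i @ [b]) * (mcycs \<pi> \<boxtimes> mcyc (Suc k)))"
    "length i = n" "sum_list \<pi> + k = n" "0 \<notin> set \<pi>" "n + sum_list i + b \<le> d + length \<pi>"
    by (rule cyc_basis_SucE)
  note le = length_le_sum_list[OF f(4)]
  show ?thesis
  proof (cases k)
    case 0
    \<comment> \<open>The last cycle is a single strand and closes to a circle; the sign of the lost
      cycle becomes the sign of the negated circle.\<close>
    let ?g = "signed (length \<pi>) (mdots i * mcycs \<pi>)"
    have "f = - (?g \<boxtimes> mpow b)"
      using f(2,3) 0 by (simp add: f(1) mdots_append interchange signed_Suc signed_tens_left)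
    then have "ptrace (ups n) f = - (?g \<boxtimes> circ b)"
      using f(2,3) 0 by (simp add: ptrace_neg ptrace_mpow)
    also have "\<dots> \<in> cone n ((d - b) + b)"
      using f 0 le by (intro cone_circ cyc_cone_subset nonneg_sum_base cyc_basisI) auto
    finally show ?thesis using f 0 le by simp
  next
    case (Suc m)
    then have n: "n = Suc (sum_list \<pi> + m)" using f(3) by simp
    let ?U = "mid [Up]" and ?p = "sum_list \<pi> + m"
    \<comment> \<open>The lowest crossing of the last cycle, together with the \<open>b\<close>
      dots, closes to \<open>curl b\<close>. The cycle becomes shorter but survives, so the sign is
      unchanged.\<close>
    let ?g = "signed (length (\<pi> @ [Suc m])) (mdots i * mcycs (\<pi> @ [Suc m]))"
    have len: "length i = Suc ?p" using f(2) n by simp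
    have cyc: "mcycs (\<pi> @ [Suc m]) = mcycs \<pi> \<boxtimes> mcyc (Suc m)"
      by (simp add: mcycs_append del: mcyc_simps)
    have "mcycs \<pi> \<boxtimes> mcyc (Suc k) = (mcycs (\<pi> @ [Suc m]) \<boxtimes> ?U) * (mid (ups ?p) \<boxtimes> cr)"
      using mid_ups_add[of cr "sum_list \<pi>" m]
      by (simp add: Suc cyc mcyc_Suc_right interchange tens_assoc del: mcyc_simps)
    moreover have "mdots (i @ [b]) * ((mcycs (\<pi> @ [Suc m]) \<boxtimes> ?U) * (mid (ups ?p) \<boxtimes> cr))
      = ((mdots i * mcycs (\<pi> @ [Suc m])) \<boxtimes> ?U) * (mid (ups ?p) \<boxtimes> ((?U \<boxtimes> mpow b) * cr))"
    proof -
      have 1: "mdots (i @ [b]) * (mcycs (\<pi> @ [Suc m]) \<boxtimes> ?U)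
          = ((mdots i * mcycs (\<pi> @ [Suc m])) \<boxtimes> ?U) * (mid (ups (Suc ?p)) \<boxtimes> mpow b)"
        using len by (simp add: mdots_append interchange)
      have 2: "mid (ups (Suc ?p)) \<boxtimes> mpow b = mid (ups ?p) \<boxtimes> (?U \<boxtimes> mpow b)"
        using tens_assoc[of "mid (ups ?p)" ?U "mpow b"] by simp
      have "mdots (i @ [b]) * ((mcycs (\<pi> @ [Suc m]) \<boxtimes> ?U) * (mid (ups ?p) \<boxtimes> cr))
        = (mdots (i @ [b]) * (mcycs (\<pi> @ [Suc m]) \<boxtimes> ?U)) * (mid (ups ?p) \<boxtimes> cr)"
        using len by (simp add: comp_assoc)
      also have "\<dots> = ((mdots i * mcycs (\<pi> @ [Suc m])) \<boxtimes> ?U) * (mid (ups ?p) \<boxtimes> ((?U \<boxtimes> mpow b) * cr))"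
        using len unfolding 1 2 by (simp add: comp_assoc whisker_left[symmetric])
      finally show ?thesis .
    qed
    ultimately have "f = (?g \<boxtimes> ?U) * (mid (ups ?p) \<boxtimes> ((?U \<boxtimes> mpow b) * cr))"
      using len by (simp add: f(1) signed_tens_left signed_comp_left)
    moreover have "ptrace (ups n) (mid (ups ?p) \<boxtimes> ((?U \<boxtimes> mpow b) * cr)) = mid (ups ?p) \<boxtimes> curl b"
      using ptrace_tens[of "(?U \<boxtimes> mpow b) * cr" "[Up]" "mid (ups ?p)" "ups ?p"] by (simp add: n curl_def)
    ultimately have "ptrace (ups n) f = ?g * (mid (ups ?p) \<boxtimes> curl b)"
      using ptrace_comp_left[of "mid (ups ?p) \<boxtimes> ((?U \<boxtimes> mpow b) * cr)" "ups n" ?g] len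
      by (simp add: n)
    \<comment> \<open>Losing a strand lowers the degree by one and the \<open>b\<close> dots lower
      it by \<open>b\<close>; \<open>curl b\<close> restores both. By \<open>le\<close>,
      \<open>Suc b \<le> d\<close>.\<close>
    also have "\<dots> \<in> cone (Suc ?p) (Suc ((d - Suc b) + b))"
      using f n le by (intro cone_curl cyc_cone_subset nonneg_sum_base cyc_basisI) auto
    finally show ?thesis using f(5) n le by simp
  qed
qed

lemma ptrace_cone:
  assumes "f \<in> cone (Suc n) d"
  shows "ptrace (ups n) f \<in> cone n d"
  using assms
proof (rule nonneg_sum_map[where h = "ptrace (ups n)"])
  fix b assume "b \<in> basis (Suc n) d"
  then obtain ks f e where b: "b = bub ks \<boxtimes> f" "f \<in> cyc_basis (Suc n) e" "sum_list ks + e \<le> d"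
    by (auto simp: basis_def)
  have "ptrace (ups n) b = bub ks \<boxtimes> ptrace (ups n) f"
    using ptrace_tens[of f "ups n" "bub ks" "[]"] cyc_basis_endo[OF b(2)] by (simp add: b(1))
  also have "\<dots> \<in> cone n (sum_list ks + e)"
    by (intro bub_cone ptrace_cyc_basis b)
  finally show "ptrace (ups n) b \<in> cone n d"
    by (rule cone_mono) (use b in auto)
qed (auto dest!: cone_endo simp: ptrace_add)

section \<open>Full closures and polynomials\<close>

lift_definition mcups :: "nat \<Rightarrow> mor" is nested_cups .
lift_definition mcaps :: "nat \<Rightarrow> mor" is nested_caps .

lemma mcups_simps:
  "mcups 0 = mid []" "mcups (Suc n) = (mid [Up] \<boxtimes> (mcups n \<boxtimes> mid [Down])) * cup Up"
  by (transfer, simp add: heq_refl)+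

lemma mcaps_simps:
  "mcaps 0 = mid []" "mcaps (Suc n) = cap Up * (mid [Up] \<boxtimes> (mcaps n \<boxtimes> mid [Down]))"
  by (transfer, simp add: heq_refl)+

lemma mcups_typing [simp]: "mwf (mcups n)" "msrc (mcups n) = []" "mtgt (mcups n) = ups n @ downs n"
  using nested_cups_hom[of n] by (transfer, simp add: hom_def)+

lemma mcaps_typing [simp]: "mwf (mcaps n)" "msrc (mcaps n) = ups n @ downs n" "mtgt (mcaps n) = []"
  using nested_caps_hom[of n] by (transfer, simp add: hom_def)+

text \<open>The recursion adds the outermost arc. Here the innermost arc is split off, since it
  belongs to the last strand, the one that \<open>ptrace\<close> closes;
  \<open>mcaps_Suc_inner\<close> is the counterpart at the top.\<close>

lemma mcups_Suc_inner:
  "mcups (Suc n) = (mid (ups n) \<boxtimes> (cup Up \<boxtimes> mid (downs n))) * mcups n"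
proof (induction n)
  case (Suc n)
  have "mcups (Suc (Suc n)) = (mid [Up] \<boxtimes> (((mid (ups n) \<boxtimes> (cup Up \<boxtimes> mid (downs n))) * mcups n) \<boxtimes> mid [Down])) * cup Up"
    by (subst mcups_simps(2), subst Suc.IH) simp
  also have "\<dots> = (mid [Up] \<boxtimes> ((mid (ups n) \<boxtimes> (cup Up \<boxtimes> mid (downs n))) \<boxtimes> mid [Down])) * mcups (Suc n)"
    by (simp add: mcups_simps(2) whisker_left[symmetric] whisker_right[symmetric] comp_assoc)
  also have "mid [Up] \<boxtimes> ((mid (ups n) \<boxtimes> (cup Up \<boxtimes> mid (downs n))) \<boxtimes> mid [Down])
     = mid (ups (Suc n)) \<boxtimes> (cup Up \<boxtimes> mid (downs (Suc n)))"
    by (simp add: tens_assoc tens_id_Cons replicate_append_same)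
  finally show ?case .
qed (simp add: mcups_simps)

lemma mcaps_Suc_inner:
  "mcaps (Suc n) = mcaps n * (mid (ups n) \<boxtimes> (cap Up \<boxtimes> mid (downs n)))"
proof (induction n)
  case (Suc n)
  have "mcaps (Suc (Suc n)) = cap Up * (mid [Up] \<boxtimes> ((mcaps n * (mid (ups n) \<boxtimes> (cap Up \<boxtimes> mid (downs n)))) \<boxtimes> mid [Down]))"
    by (subst mcaps_simps(2), subst Suc.IH) simp
  also have "\<dots> = mcaps (Suc n) * (mid [Up] \<boxtimes> ((mid (ups n) \<boxtimes> (cap Up \<boxtimes> mid (downs n))) \<boxtimes> mid [Down]))"
    by (simp add: mcaps_simps(2) whisker_left[symmetric] whisker_right[symmetric] comp_assoc)
  also have "mid [Up] \<boxtimes> ((mid (ups n) \<boxtimes> (cap Up \<boxtimes> mid (downs n))) \<boxtimes> mid [Down])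
     = mid (ups (Suc n)) \<boxtimes> (cap Up \<boxtimes> mid (downs (Suc n)))"
    by (simp add: tens_assoc tens_id_Cons replicate_append_same)
  finally show ?case .
qed (simp add: mcaps_simps)

lift_definition mclosure :: "nat \<Rightarrow> mor \<Rightarrow> mor" is closure_diag
  unfolding closure_diag_def by (intro heq_comp heq_tens heq_refl)

lemma mclosure_eq: "mclosure n f = mcaps n * ((f \<boxtimes> mid (downs n)) * mcups n)"
  by transfer (simp add: closure_diag_def heq_refl)

lemma mclosure_Suc:
  assumes "endo (Suc n) f"
  shows "mclosure (Suc n) f = mclosure n (ptrace (ups n) f)"
proof -
  let ?D = "mid (downs n)"
  have "f \<boxtimes> mid (downs (Suc n)) = (f \<boxtimes> mid [Down]) \<boxtimes> ?D"
    using assms by (simp add: tens_assoc)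
  then have "mclosure (Suc n) f = mcaps n * (((mid (ups n) \<boxtimes> cap Up) \<boxtimes> ?D) * (((f \<boxtimes> mid [Down]) \<boxtimes> ?D) *
     (((mid (ups n) \<boxtimes> cup Up) \<boxtimes> ?D) * mcups n)))"
    using assms by (simp add: mclosure_eq mcaps_Suc_inner mcups_Suc_inner comp_assoc tens_assoc)
  also have "\<dots> = mclosure n (ptrace (ups n) f)"
    using assms by (simp add: mclosure_eq ptrace_def whisker_right[symmetric] comp_assoc)
  finally show ?thesis .
qed

lemma mclosure_cone: "f \<in> cone n d \<Longrightarrow> mclosure n f \<in> cone 0 d"
proof (induction n arbitrary: f)
  case 0
  then show ?case using cone_endo[OF 0] by (simp add: mclosure_eq mcaps_simps mcups_simps)
next
  case (Suc n)
  then show ?case using cone_endo[OF Suc.prems] by (simp add: mclosure_Suc ptrace_cone)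
qed

text \<open>Without strands the partition and the list of dots are empty and the sign is trivial, so
  only monomials in negated circles remain.\<close>

lemma basis_0: "basis 0 d \<subseteq> {bub ks | ks. sum_list ks \<le> d}"
proof
  fix f assume "f \<in> basis 0 d"
  then obtain ks g e where f: "f = bub ks \<boxtimes> g" "g \<in> cyc_basis 0 e" "sum_list ks + e \<le> d"
    by (auto simp: basis_def)
  from f(2) obtain \<pi> i where g: "g = signed (length \<pi>) (mdots i * mcycs \<pi>)" "length i = 0" "sum_list \<pi> = 0" "0 \<notin> set \<pi>"
    by (rule cyc_basisE)
  have "\<pi> = []" using length_le_sum_list[OF g(4)] g(3) by simp
  then have "f = bub ks" using f(1) g(1,2) by simp
  then show "f \<in> {bub ks | ks. sum_list ks \<le> d}" using f(3) by auto
qed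

text \<open>Both types are quotients by the same congruence, \<open>end_unit\<close> restricted to
  \<open>hom [] []\<close>. This inclusion transports the result from \<open>mor\<close> back to the
  ring.\<close>

lift_definition mor_of :: "end_unit \<Rightarrow> mor" is "\<lambda>f. f" by simp

lemma mor_of_inject: "mor_of a = mor_of b \<Longrightarrow> a = b"
  by transfer auto

lemma mor_of_typing [simp]: "mwf (mor_of a)" "msrc (mor_of a) = []" "mtgt (mor_of a) = []"
  by (transfer, auto simp: hom_def)+

lemma mor_of_hom:
  "mor_of 1 = mid []" "mor_of (a + b) = mor_of a + mor_of b" "mor_of (a * b) = mor_of a * mor_of b"
  "mor_of (- a) = - mor_of a"
  by (transfer, simp add: heq_refl)+

lemma mor_of_abs: "f \<in> hom [] [] \<Longrightarrow> mor_of (abs_end_unit f) = abs_mor f"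
  by (rule mor_of.abs_eq) (simp add: heq_refl)

lemma mor_of_cw_circle: "mor_of (cw_circle k) = circ k"
  by (simp add: cw_circle_def mor_of_abs circle_diag_hom circ.abs_eq)

lemma bub_eq: "bub ks = mor_of (\<Prod>k\<leftarrow>ks. - cw_circle k)"
proof (induction ks)
  case (Cons k ks)
  then show ?case
    using tens_comp_left[of "- circ k" "bub ks" "[]" "[]"] by (simp add: mor_of_hom mor_of_cw_circle comp_neg_left)
qed (simp add: mor_of_hom)

section \<open>Evaluation and degree of polynomials\<close>

definition mon_eval :: "(nat \<Rightarrow> end_unit) \<Rightarrow> monomial \<Rightarrow> end_unit" where
  "mon_eval y m = (\<Prod>k\<in>Poly_Mapping.keys m. y k ^ Poly_Mapping.lookup m k)"

lemma mon_eval_superset: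
  assumes "finite A" "Poly_Mapping.keys m \<subseteq> A"
  shows "mon_eval y m = (\<Prod>k\<in>A. y k ^ Poly_Mapping.lookup m k)"
  unfolding mon_eval_def using assms by (intro prod.mono_neutral_left) (auto simp: in_keys_iff)

lemma mon_degree_superset:
  assumes "finite A" "Poly_Mapping.keys m \<subseteq> A"
  shows "mon_degree m = (\<Sum>k\<in>A. k * Poly_Mapping.lookup m k)"
  unfolding mon_degree_def using assms by (intro sum.mono_neutral_left) (auto simp: in_keys_iff)

lemma mon_eval_add: "mon_eval y (m + m') = mon_eval y m * mon_eval y m'"
proof -
  let ?A = "Poly_Mapping.keys m \<union> Poly_Mapping.keys m'"
  have "Poly_Mapping.keys (m + m') \<subseteq> ?A" by (rule Poly_Mapping.keys_add)
  then show ?thesis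
    by (simp add: mon_eval_superset[of ?A] lookup_add power_add prod.distrib)
qed

lemma mon_degree_add: "mon_degree (m + m') = mon_degree m + mon_degree m'"
proof -
  let ?A = "Poly_Mapping.keys m \<union> Poly_Mapping.keys m'"
  have "Poly_Mapping.keys (m + m') \<subseteq> ?A" by (rule Poly_Mapping.keys_add)
  then show ?thesis
    by (simp add: mon_degree_superset[of ?A] lookup_add algebra_simps sum.distrib)
qed

lemma cscale_simps:
  "cscale 0 a = 0" "cscale 1 a = a" "cscale (z + w) a = cscale z a + cscale w a"
  by (transfer, auto simp: hom_def intro!: heq_linear intro: linear_rel.intros,
      metis l_scale_zero)
     (transfer, auto simp: hom_def intro!: heq_linear intro: linear_rel.intros)+

lemma poly_eval_superset:
  assumes "finite A" "Poly_Mapping.keys P \<subseteq> A"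
  shows "poly_eval P y = (\<Sum>m\<in>A. cscale (of_int (Poly_Mapping.lookup P m)) (mon_eval y m))"
  unfolding poly_eval_def mon_eval_def[symmetric]
  using assms by (intro sum.mono_neutral_left) (auto simp: in_keys_iff cscale_simps)

lemma poly_eval_add: "poly_eval (P + Q) y = poly_eval P y + poly_eval Q y"
proof -
  let ?A = "Poly_Mapping.keys P \<union> Poly_Mapping.keys Q"
  have "Poly_Mapping.keys (P + Q) \<subseteq> ?A" by (rule Poly_Mapping.keys_add)
  then show ?thesis
    by (simp add: poly_eval_superset[of ?A] lookup_add cscale_simps sum.distrib)
qed

text \<open>The exponents of the monomial count the occurrences of each index in
  \<open>ks\<close>.\<close>

lemma prod_list_mon_eval:
  "\<exists>m. (\<Prod>k\<leftarrow>ks. y k) = mon_eval y m \<and> mon_degree m = sum_list ks"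
proof (induction ks)
  case Nil
  show ?case by (rule exI[of _ 0]) (simp add: mon_eval_def mon_degree_def)
next
  case (Cons k ks)
  then obtain m where "(\<Prod>k\<leftarrow>ks. y k) = mon_eval y m" "mon_degree m = sum_list ks" by blast
  moreover have "mon_eval y (Poly_Mapping.single k 1) = y k" "mon_degree (Poly_Mapping.single k 1) = k"
    by (simp_all add: mon_eval_def mon_degree_def)
  ultimately show ?case
    by (intro exI[of _ "Poly_Mapping.single k 1 + m"]) (simp add: mon_eval_add mon_degree_add)
qed

text \<open>A single \<open>bub ks\<close> gives a monomial with coefficient 1, and sums in the cone
  add polynomials, which keeps coefficients non-negative and creates no new monomials.\<close>

lemma cone_0_polynomial:
  assumes "f \<in> cone 0 d"
  shows "\<exists>P. (\<forall>m. Poly_Mapping.lookup P m \<ge> 0) \<and> f = mor_of (poly_eval P (\<lambda>k. - cw_circle k)) \<and>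
    (\<forall>m\<in>Poly_Mapping.keys P. mon_degree m \<le> d)"
  using assms
proof induction
  case (nonneg_sum_base f)
  then obtain ks where f: "f = bub ks" "sum_list ks \<le> d" using basis_0 by blast
  obtain m where m: "(\<Prod>k\<leftarrow>ks. - cw_circle k) = mon_eval (\<lambda>k. - cw_circle k) m" "mon_degree m = sum_list ks"
    using prod_list_mon_eval by blast
  show ?case
    by (rule exI[of _ "Poly_Mapping.single m 1"])
      (use f m in \<open>simp add: bub_eq poly_eval_def mon_eval_def cscale_simps lookup_single when_def\<close>)
next
  case (nonneg_sum_add f g)
  then obtain P Q where PQ:
    "\<forall>m. Poly_Mapping.lookup P m \<ge> 0" "f = mor_of (poly_eval P (\<lambda>k. - cw_circle k))"
    "\<forall>m\<in>Poly_Mapping.keys P. mon_degree m \<le> d"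
    "\<forall>m. Poly_Mapping.lookup Q m \<ge> 0" "g = mor_of (poly_eval Q (\<lambda>k. - cw_circle k))"
    "\<forall>m\<in>Poly_Mapping.keys Q. mon_degree m \<le> d"
    by blast
  show ?case
    by (rule exI[of _ "P + Q"])
      (use PQ Poly_Mapping.keys_add[of P Q] in \<open>auto simp: lookup_add poly_eval_add mor_of_hom\<close>)
qed

lemma mor_of_alpha:
  assumes "sum_list \<pi> = length idx"
  shows "mor_of (alpha \<pi> idx) = mclosure (length idx) (mdots idx * mcycs \<pi>)"
  by (simp add: alpha_def mor_of_abs alpha_diag_hom assms)
    (transfer, simp add: alpha_diag_def heq_refl)

lemma mor_of_sign: "mor_of ((- 1) ^ l * a) = signed l (mor_of a)"
  by (induction l) (simp_all add: signed_Suc mor_of_hom)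

lemma mclosure_signed: "endo n f \<Longrightarrow> mclosure n (signed l f) = signed l (mclosure n f)"
  by (auto simp: signed_def mclosure_eq linear_mor)

theorem theorem4p1:
  fixes n :: nat and \<pi> idx :: "nat list"
  assumes "n \<ge> 1" and "is_partition n \<pi>" and "length idx = n"
  shows "\<exists>P :: monomial \<Rightarrow>\<^sub>0 int.
           (\<forall>m. Poly_Mapping.lookup P m \<ge> 0) \<and>
           (- 1) ^ length \<pi> * alpha \<pi> idx = poly_eval P (\<lambda>k. - cw_circle k) \<and>
           (\<forall>m\<in>Poly_Mapping.keys P. mon_degree m \<le> n - length \<pi> + sum_list idx)"
proof -
  let ?f = "mdots idx * mcycs \<pi>"
  have \<pi>: "sum_list \<pi> = n" "0 \<notin> set \<pi>"
    using assms(2) by (auto simp: is_partition_def)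
  \<comment> \<open>Without circles, this basis element has exactly the claimed degree, and closing
    all strands does not raise it.\<close>
  have "signed (length \<pi>) ?f \<in> cone n (n - length \<pi> + sum_list idx)"
    using assms(3) \<pi> length_le_sum_list[of \<pi>]
    by (intro cyc_cone_subset nonneg_sum_base cyc_basisI) auto
  then have "mclosure n (signed (length \<pi>) ?f) \<in> cone 0 (n - length \<pi> + sum_list idx)"
    by (rule mclosure_cone)
  moreover have "mclosure n (signed (length \<pi>) ?f) = mor_of ((- 1) ^ length \<pi> * alpha \<pi> idx)"
    using assms(3) \<pi> by (simp add: mor_of_sign mor_of_alpha mclosure_signed)
  ultimately have "mor_of ((- 1) ^ length \<pi> * alpha \<pi> idx) \<in> cone 0 (n - length \<pi> + sum_list idx)"
    by simp
  from cone_0_polynomial[OF this] show ?thesis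
    using mor_of_inject by blast
qed

end
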